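(* Any cover-special event structure admits a regular trace labeling; i.e., every cover-special event structure is a regular trace event structure.
   Context: An event structure is $(E,\le,\#)$ with $\le$ a partial order, finite down-sets, $\#$ irreflexive symmetric, and $e\#e'$, $e'\le e''$ implying $e\#e''$; configurations are finite conflict-free down-closed sets; the domain is the set of configurations ordered by inclusion. An NPC complex is a cube complex with flag vertex links; a directed NPC complex has an admissible orientation (opposite edges of each square oriented the same way), which lifts to the universal cover $\widetilde X$ as $\widetilde o$; the principal filter of a vertex $\widetilde v$ is the set of vertices reachable from $\widetilde v$ by directed paths, ordered by reachability. A finite NPC complex $Y$ is special if its hyperplanes are two-sided, no hyperplane self-intersects or directly self-osculates, and no two hyperplanes both intersect and osculate (standard Haglund–Wise definition). A finite NPC complex $X$ is virtually special if there is a finite special NPC complex $Y$ and a covering map $Y\to X$. An event structure is cover-special if its domain is isomorphic to a principal filter of $(\widetilde X,\widetilde o)$ for some finite virtually special complex $X$ with an admissible orientation $o$. A trace alphabet is $(\Sigma,I)$, $\Sigma$ finite, $I$ irreflexive symmetric, $D$ its complement in $\Sigma\times\Sigma$. A trace labeling $\lambda:E\to\Sigma$ satisfies: $e\#_\mu e'\Rightarrow\lambda(e)\ne\lambda(e')$; if $e\lessdot e'$ or $e\#_\mu e'$ then $(\lambda(e),\lambda(e'))\in D$; if $(\lambda(e),\lambda(e'))\in D$ then $e\le e'$, $e'\le e$ or $e\#e'$ (where $\#_\mu$ is minimal conflict and $\lessdot$ the covering relation of $\le$). It is regular if there are finitely many label-preserving isomorphism classes of labeled futures $\{c'\supseteq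 c\}$ of configurations $c$. *)

theory Defs
  imports Main
begin

definition event_structure :: "'a set \<Rightarrow> ('a \<Rightarrow> 'a \<Rightarrow> bool) \<Rightarrow> ('a \<Rightarrow> 'a \<Rightarrow> bool) \<Rightarrow> bool" where
  "event_structure E le cf \<longleftrightarrow>
     (\<forall>e\<in>E. le e e) \<and>
     (\<forall>e\<in>E. \<forall>e'\<in>E. le e e' \<and> le e' e \<longrightarrow> e = e') \<and>
     (\<forall>e\<in>E. \<forall>e'\<in>E. \<forall>e''\<in>E. le e e' \<and> le e' e'' \<longrightarrow> le e e'') \<and>
     (\<forall>e\<in>E. finite {e'\<in>E. le e' e}) \<and>
     (\<forall>e\<in>E. \<not> cf e e) \<and>
     (\<forall>e\<in>E. \<forall>e'\<in>E. cf e e' \<longrightarrow> cf e' e) \<and>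
     (\<forall>e\<in>E. \<forall>e'\<in>E. \<forall>e''\<in>E. cf e e' \<and> le e' e'' \<longrightarrow> cf e e'')"

definition configurations :: "'a set \<Rightarrow> ('a \<Rightarrow> 'a \<Rightarrow> bool) \<Rightarrow> ('a \<Rightarrow> 'a \<Rightarrow> bool) \<Rightarrow> 'a set set" where
  "configurations E le cf =
     {c. c \<subseteq> E \<and> finite c \<and> (\<forall>e\<in>c. \<forall>e'\<in>c. \<not> cf e e') \<and>
         (\<forall>e\<in>c. \<forall>e'\<in>E. le e' e \<longrightarrow> e' \<in> c)}"

definition min_conflict :: "'a set \<Rightarrow> ('a \<Rightarrow> 'a \<Rightarrow> bool) \<Rightarrow> ('a \<Rightarrow> 'a \<Rightarrow> bool) \<Rightarrow> 'a \<Rightarrow> 'a \<Rightarrow> bool" where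
  "min_conflict E le cf e e' \<longleftrightarrow> e \<in> E \<and> e' \<in> E \<and> cf e e' \<and>
     (\<forall>x\<in>E. \<forall>y\<in>E. le x e \<and> le y e' \<and> cf x y \<longrightarrow> x = e \<and> y = e')"

definition lessdot :: "'a set \<Rightarrow> ('a \<Rightarrow> 'a \<Rightarrow> bool) \<Rightarrow> 'a \<Rightarrow> 'a \<Rightarrow> bool" where
  "lessdot E le e e' \<longleftrightarrow> e \<in> E \<and> e' \<in> E \<and> le e e' \<and> e \<noteq> e' \<and>
     \<not> (\<exists>x\<in>E. le e x \<and> le x e' \<and> x \<noteq> e \<and> x \<noteq> e')"

text \<open>Labels are natural numbers (any finite alphabet can be encoded in nat).
  The independence relation @I@ lives on the alphabet; @D@ is its complement in
  Sigma x Sigma.\<close>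

definition trace_alphabet :: "nat set \<Rightarrow> (nat \<Rightarrow> nat \<Rightarrow> bool) \<Rightarrow> bool" where
  "trace_alphabet Sig I \<longleftrightarrow> finite Sig \<and>
     (\<forall>a b. I a b \<longrightarrow> a \<in> Sig \<and> b \<in> Sig) \<and>
     (\<forall>a. \<not> I a a) \<and> (\<forall>a b. I a b \<longrightarrow> I b a)"

definition dep :: "nat set \<Rightarrow> (nat \<Rightarrow> nat \<Rightarrow> bool) \<Rightarrow> nat \<Rightarrow> nat \<Rightarrow> bool" where
  "dep Sig I a b \<longleftrightarrow> a \<in> Sig \<and> b \<in> Sig \<and> \<not> I a b"

definition trace_labeling ::
  "'a set \<Rightarrow> ('a \<Rightarrow> 'a \<Rightarrow> bool) \<Rightarrow> ('a \<Rightarrow> 'a \<Rightarrow> bool) \<Rightarrow> nat set \<Rightarrow> (nat \<Rightarrow> nat \<Rightarrow> bool)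
     \<Rightarrow> ('a \<Rightarrow> nat) \<Rightarrow> bool" where
  "trace_labeling E le cf Sig I lab \<longleftrightarrow>
     (\<forall>e\<in>E. lab e \<in> Sig) \<and>
     (\<forall>e\<in>E. \<forall>e'\<in>E. min_conflict E le cf e e' \<longrightarrow> lab e \<noteq> lab e') \<and>
     (\<forall>e\<in>E. \<forall>e'\<in>E. (lessdot E le e e' \<or> min_conflict E le cf e e') \<longrightarrow> dep Sig I (lab e) (lab e')) \<and>
     (\<forall>e\<in>E. \<forall>e'\<in>E. dep Sig I (lab e) (lab e') \<longrightarrow> le e e' \<or> le e' e \<or> cf e e')"

definition future :: "'a set \<Rightarrow> ('a \<Rightarrow> 'a \<Rightarrow> bool) \<Rightarrow> ('a \<Rightarrow> 'a \<Rightarrow> bool) \<Rightarrow> 'a set \<Rightarrow> 'a set set" where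
  "future E le cf c = {c'. c' \<in> configurations E le cf \<and> c \<subseteq> c'}"

definition future_iso ::
  "'a set \<Rightarrow> ('a \<Rightarrow> 'a \<Rightarrow> bool) \<Rightarrow> ('a \<Rightarrow> 'a \<Rightarrow> bool) \<Rightarrow> ('a \<Rightarrow> nat) \<Rightarrow> 'a set \<Rightarrow> 'a set \<Rightarrow> bool" where
  "future_iso E le cf lab c d \<longleftrightarrow>
     (\<exists>phi. bij_betw phi (future E le cf c) (future E le cf d) \<and>
        (\<forall>c1\<in>future E le cf c. \<forall>c2\<in>future E le cf c. c1 \<subseteq> c2 \<longleftrightarrow> phi c1 \<subseteq> phi c2) \<and>
        (\<forall>c1\<in>future E le cf c. \<forall>e. e \<notin> c1 \<and> insert e c1 \<in> future E le cf c \<longrightarrow>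
            (\<exists>e'. e' \<notin> phi c1 \<and> phi (insert e c1) = insert e' (phi c1) \<and> lab e' = lab e)))"

definition regular_labeling ::
  "'a set \<Rightarrow> ('a \<Rightarrow> 'a \<Rightarrow> bool) \<Rightarrow> ('a \<Rightarrow> 'a \<Rightarrow> bool) \<Rightarrow> ('a \<Rightarrow> nat) \<Rightarrow> bool" where
  "regular_labeling E le cf lab \<longleftrightarrow>
     (\<exists>R. finite R \<and> R \<subseteq> configurations E le cf \<and>
        (\<forall>c\<in>configurations E le cf. \<exists>d\<in>R. future_iso E le cf lab c d))"

definition regular_trace_event_structure ::
  "'a set \<Rightarrow> ('a \<Rightarrow> 'a \<Rightarrow> bool) \<Rightarrow> ('a \<Rightarrow> 'a \<Rightarrow> bool) \<Rightarrow> bool" where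
  "regular_trace_event_structure E le cf \<longleftrightarrow>
     (\<exists>Sig I lab. trace_alphabet Sig I \<and> trace_labeling E le cf Sig I lab \<and>
        regular_labeling E le cf lab)"

text \<open>A cube complex with an admissible orientation is modelled combinatorially:
  a directed graph (vertices, oriented edges with src/tgt) together with a set of
  cube maps.  An n-cube map c = (n, cv, ce) sends each vertex S (a subset of {..<n})
  of the standard oriented n-cube to cv S, and the edge from S to insert i S
  (i not in S) to the oriented edge ce S i.  Every cube is oriented coherently with
  the standard cube, which is exactly admissibility of the orientation.  The set of
  cube maps is closed under taking faces and permuting coordinates; a cell of the
  complex is an orbit under coordinate permutations.\<close>

type_synonym ('v, 'e) cube = "nat \<times> (nat set \<Rightarrow> 'v) \<times> (nat set \<Rightarrow> nat \<Rightarrow> 'e)"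

definition cdim :: "('v, 'e) cube \<Rightarrow> nat" where "cdim c = fst c"
definition cv :: "('v, 'e) cube \<Rightarrow> nat set \<Rightarrow> 'v" where "cv c = fst (snd c)"
definition ce :: "('v, 'e) cube \<Rightarrow> nat set \<Rightarrow> nat \<Rightarrow> 'e" where "ce c = snd (snd c)"

record ('v, 'e) dcomplex =
  verts :: "'v set"
  edges :: "'e set"
  src :: "'e \<Rightarrow> 'v"
  tgt :: "'e \<Rightarrow> 'v"
  cubes :: "('v, 'e) cube set"

definition same_cube :: "('v, 'e) cube \<Rightarrow> ('v, 'e) cube \<Rightarrow> bool" where
  "same_cube c d \<longleftrightarrow> cdim c = cdim d \<and>
     (\<forall>S. S \<subseteq> {..<cdim c} \<longrightarrow> cv c S = cv d S) \<and>
     (\<forall>S i. S \<subseteq> {..<cdim c} \<and> i < cdim c \<and> i \<notin> S \<longrightarrow> ce c S i = ce d S i)"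

definition has_cube :: "('v, 'e, 'z) dcomplex_scheme \<Rightarrow> ('v, 'e) cube \<Rightarrow> bool" where
  "has_cube X c \<longleftrightarrow> (\<exists>d\<in>cubes X. same_cube c d)"

definition well_formed_cube :: "('v, 'e, 'z) dcomplex_scheme \<Rightarrow> ('v, 'e) cube \<Rightarrow> bool" where
  "well_formed_cube X c \<longleftrightarrow>
     (\<forall>S. S \<subseteq> {..<cdim c} \<longrightarrow> cv c S \<in> verts X) \<and>
     (\<forall>S i. S \<subseteq> {..<cdim c} \<and> i < cdim c \<and> i \<notin> S \<longrightarrow>
        ce c S i \<in> edges X \<and> src X (ce c S i) = cv c S \<and> tgt X (ce c S i) = cv c (insert i S))"

text \<open>Sub-cube of c: fix the coordinates in A to 1, the coordinates outside A and
  outside the image of g to 0, and let the k free coordinates run along g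
  (g injective).  This covers faces and coordinate permutations at once.\<close>

definition subcube :: "('v, 'e) cube \<Rightarrow> nat set \<Rightarrow> nat \<Rightarrow> (nat \<Rightarrow> nat) \<Rightarrow> ('v, 'e) cube" where
  "subcube c A k g = (k, \<lambda>T. cv c (A \<union> g ` T), \<lambda>T j. ce c (A \<union> g ` T) (g j))"

definition dcomplex :: "('v, 'e, 'z) dcomplex_scheme \<Rightarrow> bool" where
  "dcomplex X \<longleftrightarrow>
     (\<forall>e\<in>edges X. src X e \<in> verts X \<and> tgt X e \<in> verts X) \<and>
     (\<forall>c\<in>cubes X. well_formed_cube X c) \<and>
     (\<forall>c\<in>cubes X. \<forall>A k g. A \<subseteq> {..<cdim c} \<and> inj_on g {..<k} \<and> g ` {..<k} \<subseteq> {..<cdim c} - A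
         \<longrightarrow> has_cube X (subcube c A k g)) \<and>
     (\<forall>v\<in>verts X. has_cube X (0, \<lambda>S. v, \<lambda>S i. undefined)) \<and>
     (\<forall>e\<in>edges X. has_cube X (1, \<lambda>S. if S = {} then src X e else tgt X e, \<lambda>S i. e))"

definition finite_dcomplex :: "('v, 'e, 'z) dcomplex_scheme \<Rightarrow> bool" where
  "finite_dcomplex X \<longleftrightarrow> finite (verts X) \<and> finite (edges X)"

text \<open>Vertices of the link of v: edge-ends at v; (e, True) means e leaves v,
  (e, False) means e enters v.  The corner of cube c at its vertex S spans the
  link simplex corner_set c S.\<close>

definition edge_ends :: "('v, 'e, 'z) dcomplex_scheme \<Rightarrow> 'v \<Rightarrow> ('e \<times> bool) set" where
  "edge_ends X v = {(e, True) | e. e \<in> edges X \<and> src X e = v} \<union>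
                   {(e, False) | e. e \<in> edges X \<and> tgt X e = v}"

definition corner_end :: "('v, 'e) cube \<Rightarrow> nat set \<Rightarrow> nat \<Rightarrow> 'e \<times> bool" where
  "corner_end c S i = (if i \<in> S then (ce c (S - {i}) i, False) else (ce c S i, True))"

definition corner_set :: "('v, 'e) cube \<Rightarrow> nat set \<Rightarrow> ('e \<times> bool) set" where
  "corner_set c S = corner_end c S ` {..<cdim c}"

definition square_corner :: "('v, 'e, 'z) dcomplex_scheme \<Rightarrow> 'v \<Rightarrow> 'e \<times> bool \<Rightarrow> 'e \<times> bool \<Rightarrow> bool" where
  "square_corner X v x y \<longleftrightarrow>
     (\<exists>c\<in>cubes X. cdim c = 2 \<and> (\<exists>S. S \<subseteq> {..<2} \<and> cv c S = v \<and> corner_set c S = {x, y}))"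

text \<open>NPC: links are simplicial complexes (no degenerate simplices, no two
  simplices with the same vertex set) and flag.\<close>

definition npc :: "('v, 'e, 'z) dcomplex_scheme \<Rightarrow> bool" where
  "npc X \<longleftrightarrow>
     (\<forall>c\<in>cubes X. \<forall>S. S \<subseteq> {..<cdim c} \<longrightarrow> inj_on (corner_end c S) {..<cdim c}) \<and>
     (\<forall>c\<in>cubes X. \<forall>d\<in>cubes X. \<forall>S T. S \<subseteq> {..<cdim c} \<and> T \<subseteq> {..<cdim d} \<and>
         cv c S = cv d T \<and> corner_set c S = corner_set d T \<longrightarrow>
         (\<exists>p. bij_betw p {..<cdim d} {..<cdim c} \<and> p ` T = S \<and>
              same_cube d (subcube c {} (cdim d) p))) \<and>
     (\<forall>v\<in>verts X. \<forall>F. F \<subseteq> edge_ends X v \<and> finite F \<and>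
         (\<forall>x\<in>F. \<forall>y\<in>F. x \<noteq> y \<longrightarrow> square_corner X v x y) \<longrightarrow>
         (\<exists>c\<in>cubes X. \<exists>S. S \<subseteq> {..<cdim c} \<and> cv c S = v \<and> corner_set c S = F))"

definition step_src :: "('v, 'e, 'z) dcomplex_scheme \<Rightarrow> 'e \<times> bool \<Rightarrow> 'v" where
  "step_src X s = (if snd s then src X (fst s) else tgt X (fst s))"

definition step_tgt :: "('v, 'e, 'z) dcomplex_scheme \<Rightarrow> 'e \<times> bool \<Rightarrow> 'v" where
  "step_tgt X s = (if snd s then tgt X (fst s) else src X (fst s))"

fun path_from :: "('v, 'e, 'z) dcomplex_scheme \<Rightarrow> 'v \<Rightarrow> ('e \<times> bool) list \<Rightarrow> bool" where
  "path_from X u [] = True"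
| "path_from X u (s # p) =
     (fst s \<in> edges X \<and> step_src X s = u \<and> path_from X (step_tgt X s) p)"

definition directed_path :: "('e \<times> bool) list \<Rightarrow> bool" where
  "directed_path p \<longleftrightarrow> (\<forall>s\<in>set p. snd s)"

definition base_move :: "('v, 'e, 'z) dcomplex_scheme \<Rightarrow> ('e \<times> bool) list \<Rightarrow> ('e \<times> bool) list \<Rightarrow> bool" where
  "base_move X m m' \<longleftrightarrow>
     (\<exists>e b. m = [(e, b), (e, \<not> b)] \<and> m' = []) \<or>
     (\<exists>c\<in>cubes X. cdim c = 2 \<and>
        m = [(ce c {} 0, True), (ce c {0} 1, True)] \<and>
        m' = [(ce c {} 1, True), (ce c {1} 0, True)])"

definition path_move :: "('v, 'e, 'z) dcomplex_scheme \<Rightarrow> 'v \<Rightarrow> ('e \<times> bool) list \<Rightarrow> ('e \<times> bool) list \<Rightarrow> bool" where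
  "path_move X u p q \<longleftrightarrow> path_from X u p \<and> path_from X u q \<and>
     (\<exists>x m m' y. p = x @ m @ y \<and> q = x @ m' @ y \<and> base_move X m m')"

definition homotopic :: "('v, 'e, 'z) dcomplex_scheme \<Rightarrow> 'v \<Rightarrow> ('e \<times> bool) list \<Rightarrow> ('e \<times> bool) list \<Rightarrow> bool" where
  "homotopic X u = (\<lambda>p q. path_move X u p q \<or> path_move X u q p)\<^sup>*\<^sup>*"

text \<open>Vertices of the universal cover reachable from the lift of u by directed
  paths (lifted orientation) = homotopy classes of directed edge paths starting at u.\<close>

definition hclass :: "('v, 'e, 'z) dcomplex_scheme \<Rightarrow> 'v \<Rightarrow> ('e \<times> bool) list \<Rightarrow> ('e \<times> bool) list set" where
  "hclass X u p = {q. path_from X u q \<and> homotopic X u p q}"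

definition principal_filter :: "('v, 'e, 'z) dcomplex_scheme \<Rightarrow> 'v \<Rightarrow> ('e \<times> bool) list set set" where
  "principal_filter X u = {hclass X u p | p. path_from X u p \<and> directed_path p}"

definition pf_le :: "('e \<times> bool) list set \<Rightarrow> ('e \<times> bool) list set \<Rightarrow> bool" where
  "pf_le P Q \<longleftrightarrow> (\<exists>p\<in>P. \<exists>r. directed_path r \<and> p @ r \<in> Q)"

definition covering_map ::
  "('v, 'e, 'z) dcomplex_scheme \<Rightarrow> ('w, 'f, 'y) dcomplex_scheme \<Rightarrow> ('v \<Rightarrow> 'w) \<Rightarrow> ('e \<Rightarrow> 'f) \<Rightarrow> bool" where
  "covering_map Y X fv fe \<longleftrightarrow>
     fv ` verts Y = verts X \<and>
     (\<forall>e\<in>edges Y. fe e \<in> edges X \<and> src X (fe e) = fv (src Y e) \<and> tgt X (fe e) = fv (tgt Y e)) \<and>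
     (\<forall>c\<in>cubes Y. has_cube X (cdim c, \<lambda>S. fv (cv c S), \<lambda>S i. fe (ce c S i))) \<and>
     (\<forall>y\<in>verts Y.
        bij_betw (\<lambda>(e, b). (fe e, b)) (edge_ends Y y) (edge_ends X (fv y)) \<and>
        (\<forall>c\<in>cubes X. \<forall>S. S \<subseteq> {..<cdim c} \<and> cv c S = fv y \<longrightarrow>
           (\<exists>d\<in>cubes Y. \<exists>T. T \<subseteq> {..<cdim d} \<and> cv d T = y \<and>
              (\<lambda>(e, b). (fe e, b)) ` corner_set d T = corner_set c S)))"

definition sq_opposite :: "('v, 'e, 'z) dcomplex_scheme \<Rightarrow> 'e \<Rightarrow> 'e \<Rightarrow> bool" where
  "sq_opposite X e e' \<longleftrightarrow> (\<exists>c\<in>cubes X. cdim c = 2 \<and> e = ce c {} 0 \<and> e' = ce c {1} 0)"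

definition hyperplanes :: "('v, 'e, 'z) dcomplex_scheme \<Rightarrow> 'e set set" where
  "hyperplanes X = {{e'. e' \<in> edges X \<and> (\<lambda>a b. sq_opposite X a b \<or> sq_opposite X b a)\<^sup>*\<^sup>* e e'} | e. e \<in> edges X}"

text \<open>Two-sidedness: dual edges can be co-oriented consistently across squares
  (sigma e says whether to reverse e).\<close>

definition two_sided :: "('v, 'e, 'z) dcomplex_scheme \<Rightarrow> 'e set \<Rightarrow> bool" where
  "two_sided X H \<longleftrightarrow> (\<exists>sigma :: 'e \<Rightarrow> bool. \<forall>c\<in>cubes X. cdim c = 2 \<and> ce c {} 0 \<in> H \<longrightarrow>
       sigma (ce c {} 0) = sigma (ce c {1} 0))"

definition self_intersects :: "('v, 'e, 'z) dcomplex_scheme \<Rightarrow> 'e set \<Rightarrow> bool" where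
  "self_intersects X H \<longleftrightarrow> (\<exists>c\<in>cubes X. cdim c = 2 \<and> ce c {} 0 \<in> H \<and> ce c {} 1 \<in> H)"

definition directly_self_osculates :: "('v, 'e, 'z) dcomplex_scheme \<Rightarrow> 'e set \<Rightarrow> bool" where
  "directly_self_osculates X H \<longleftrightarrow>
     (\<exists>v\<in>verts X. \<exists>e1 e2 b. (e1, b) \<in> edge_ends X v \<and> (e2, b) \<in> edge_ends X v \<and>
        e1 \<noteq> e2 \<and> e1 \<in> H \<and> e2 \<in> H \<and> \<not> square_corner X v (e1, b) (e2, b))"

definition inter_osculate :: "('v, 'e, 'z) dcomplex_scheme \<Rightarrow> 'e set \<Rightarrow> 'e set \<Rightarrow> bool" where
  "inter_osculate X H1 H2 \<longleftrightarrow> H1 \<noteq> H2 \<and>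
     (\<exists>c\<in>cubes X. cdim c = 2 \<and> ce c {} 0 \<in> H1 \<and> ce c {} 1 \<in> H2) \<and>
     (\<exists>v\<in>verts X. \<exists>e1 b1 e2 b2. (e1, b1) \<in> edge_ends X v \<and> (e2, b2) \<in> edge_ends X v \<and>
        e1 \<in> H1 \<and> e2 \<in> H2 \<and> \<not> square_corner X v (e1, b1) (e2, b2))"

definition special :: "('v, 'e, 'z) dcomplex_scheme \<Rightarrow> bool" where
  "special X \<longleftrightarrow>
     (\<forall>H\<in>hyperplanes X. two_sided X H \<and> \<not> self_intersects X H \<and> \<not> directly_self_osculates X H) \<and>
     (\<forall>H1\<in>hyperplanes X. \<forall>H2\<in>hyperplanes X. \<not> inter_osculate X H1 H2)"

text \<open>Finite complexes are encoded with vertices and edges in nat.\<close>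

definition virtually_special :: "(nat, nat) dcomplex \<Rightarrow> bool" where
  "virtually_special X \<longleftrightarrow> dcomplex X \<and> finite_dcomplex X \<and> npc X \<and>
     (\<exists>(Y :: (nat, nat) dcomplex) fv fe. dcomplex Y \<and> finite_dcomplex Y \<and> npc Y \<and>
        special Y \<and> covering_map Y X fv fe)"

definition cover_special :: "'a set \<Rightarrow> ('a \<Rightarrow> 'a \<Rightarrow> bool) \<Rightarrow> ('a \<Rightarrow> 'a \<Rightarrow> bool) \<Rightarrow> bool" where
  "cover_special E le cf \<longleftrightarrow>
     (\<exists>(X :: (nat, nat) dcomplex) u. virtually_special X \<and> u \<in> verts X \<and>
        (\<exists>f. bij_betw f (configurations E le cf) (principal_filter X u) \<and>
           (\<forall>c\<in>configurations E le cf. \<forall>c'\<in>configurations E le cf.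
               c \<subseteq> c' \<longleftrightarrow> pf_le (f c) (f c'))))"

end

theory Submission
  imports Defs
begin

text \<open>The filter of X is isomorphic to the poset of homotopy classes of directed paths in the
  special cover Y, because paths and homotopies lift uniquely. An event is a class of
  parallel edges there, and it is labelled by the hyperplane of Y dual to these edges; two labels
  are independent if the hyperplanes cross. Since there is no direct self-osculation and no
  inter-osculation, edges at a vertex of Y are determined by their labels and span a square
  as soon as the labels are independent. The geometry of the universal cover is not needed: it
  suffices that the number of signed occurrences of a label in a path is a homotopy
  invariant, as is the image of the path under any map of the labels to involutions that
  respects independence. The labelled future of a configuration depends only on
  the endpoint in Y of a path representing it, and Y is finite.\<close>

subsection \<open>Edge paths and homotopy\<close>

text \<open>The crux is to recover independence of labels from concurrency of events. The two orders
  of firing concurrent events give homotopic directed paths of length two, but the homotopy may pass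
  through longer, undirected paths, so that no square is at hand. Each path in Y has a value in the
  right-angled Artin group generated by the labels, with the pairs in I commuting, and this value is
  a homotopy invariant. The two invariants are shadows of it: the signed counts are its
  abelianization, and the involutions are an action of the associated right-angled Coxeter group.
  The counts show that the two paths carry the same two labels in opposite order, the involutions
  that these labels commute. The converse, from independent labels to a square, is the absence of
  inter-osculation. The hyperplanes of X cannot serve as labels, since X is only virtually special:
  two edges leaving a vertex of X may be dual to the same hyperplane.\<close>

fun path_end :: "('v, 'e, 'z) dcomplex_scheme \<Rightarrow> 'v \<Rightarrow> ('e \<times> bool) list \<Rightarrow> 'v" where
  "path_end X u [] = u"
| "path_end X u (s # p) = path_end X (step_tgt X s) p"

lemma path_from_append [simp]:
  "path_from X u (p @ q) \<longleftrightarrow> path_from X u p \<and> path_from X (path_end X u p) q"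
  by (induction p arbitrary: u) auto

lemma path_end_append [simp]: "path_end X u (p @ q) = path_end X (path_end X u p) q"
  by (induction p arbitrary: u) auto

lemma directed_path_simps [simp]:
  "directed_path []"
  "directed_path (s # p) \<longleftrightarrow> snd s \<and> directed_path p"
  "directed_path (p @ q) \<longleftrightarrow> directed_path p \<and> directed_path q"
  by (auto simp: directed_path_def)

lemma edge_verts:
  assumes "dcomplex X" "e \<in> edges X"
  shows "src X e \<in> verts X" "tgt X e \<in> verts X"
  using assms unfolding dcomplex_def by simp_all

lemma path_end_in_verts:
  assumes "dcomplex X" "u \<in> verts X" "path_from X u p"
  shows "path_end X u p \<in> verts X"
  using assms(2,3)
proof (induction p arbitrary: u)
  case (Cons s p)
  have "step_tgt X s \<in> verts X"
    using Cons.prems edge_verts[OF assms(1)] by (simp add: step_tgt_def)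
  then show ?case using Cons by auto
qed auto

text \<open>The edges a and b leave the initial corner and a', b' are opposite to them, so the
  square bounds the paths a b' and b a'.\<close>

definition square :: "('v, 'e, 'z) dcomplex_scheme \<Rightarrow> 'e \<Rightarrow> 'e \<Rightarrow> 'e \<Rightarrow> 'e \<Rightarrow> bool" where
  "square X a b a' b' \<longleftrightarrow> (\<exists>c\<in>cubes X. cdim c = 2 \<and>
     a = ce c {} 0 \<and> b = ce c {} 1 \<and> a' = ce c {1} 0 \<and> b' = ce c {0} 1)"

lemma base_move_iff:
  "base_move X m m' \<longleftrightarrow> (\<exists>e b. m = [(e, b), (e, \<not> b)] \<and> m' = []) \<or>
     (\<exists>a b a' b'. square X a b a' b' \<and> m = [(a, True), (b', True)] \<and> m' = [(b, True), (a', True)])"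
  unfolding base_move_def square_def by blast

lemma subset_two: "S \<subseteq> {..<2} \<longleftrightarrow> S = {} \<or> S = {0} \<or> S = {1} \<or> S = {0, 1::nat}"
proof -
  have "{..<2} = {0, 1::nat}" by auto
  then show ?thesis by (simp only:) blast
qed

lemma well_formed_square:
  assumes "well_formed_cube X c" "cdim c = 2"
  shows "ce c {} 0 \<in> edges X" "src X (ce c {} 0) = cv c {}" "tgt X (ce c {} 0) = cv c {0}"
    "ce c {} 1 \<in> edges X" "src X (ce c {} 1) = cv c {}" "tgt X (ce c {} 1) = cv c {1}"
    "ce c {1} 0 \<in> edges X" "src X (ce c {1} 0) = cv c {1}" "tgt X (ce c {1} 0) = cv c {0, 1}"
    "ce c {0} 1 \<in> edges X" "src X (ce c {0} 1) = cv c {0}" "tgt X (ce c {0} 1) = cv c {0, 1}"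
proof -
  have *: "ce c S i \<in> edges X \<and> src X (ce c S i) = cv c S \<and> tgt X (ce c S i) = cv c (insert i S)"
    if "S \<subseteq> {..<2}" "i < 2" "i \<notin> S" for S i
    using assms(1) that unfolding well_formed_cube_def assms(2) by simp
  have 10: "{1, 0} = {0, 1::nat}" by auto
  show "ce c {} 0 \<in> edges X" "src X (ce c {} 0) = cv c {}" "tgt X (ce c {} 0) = cv c {0}"
    "ce c {} 1 \<in> edges X" "src X (ce c {} 1) = cv c {}" "tgt X (ce c {} 1) = cv c {1}"
    "ce c {1} 0 \<in> edges X" "src X (ce c {1} 0) = cv c {1}" "tgt X (ce c {1} 0) = cv c {0, 1}"
    "ce c {0} 1 \<in> edges X" "src X (ce c {0} 1) = cv c {0}" "tgt X (ce c {0} 1) = cv c {0, 1}"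
    using *[of "{}" 0] *[of "{}" 1] *[of "{1}" 0] *[of "{0}" 1]
    unfolding 10 by simp_all
qed

lemma square_edges:
  assumes "dcomplex X" "square X a b a' b'"
  shows "a \<in> edges X" "b \<in> edges X" "a' \<in> edges X" "b' \<in> edges X"
    "src X b = src X a" "src X b' = tgt X a" "src X a' = tgt X b" "tgt X b' = tgt X a'"
proof -
  obtain c where "c \<in> cubes X" "cdim c = 2" and
    e: "a = ce c {} 0" "b = ce c {} 1" "a' = ce c {1} 0" "b' = ce c {0} 1"
    using assms(2) unfolding square_def by blast
  then have "well_formed_cube X c" using assms(1) by (auto simp: dcomplex_def)
  note w = well_formed_square[OF this \<open>cdim c = 2\<close>]
  show "a \<in> edges X" "b \<in> edges X" "a' \<in> edges X" "b' \<in> edges X"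
    "src X b = src X a" "src X b' = tgt X a" "src X a' = tgt X b" "tgt X b' = tgt X a'"
    using w unfolding e by simp_all
qed

lemma same_square_edges:
  assumes "same_cube c d" "cdim d = 2"
  shows "cdim c = 2" "ce c {} 0 = ce d {} 0" "ce c {} 1 = ce d {} 1"
    "ce c {1} 0 = ce d {1} 0" "ce c {0} 1 = ce d {0} 1"
proof -
  have 2: "cdim c = 2" using assms by (simp add: same_cube_def)
  have "ce c S i = ce d S i" if "S \<subseteq> {..<2}" "i < 2" "i \<notin> S" for S i
    using assms(1) that 2 unfolding same_cube_def by metis
  from this[of "{}" 0] this[of "{}" 1] this[of "{1}" 0] this[of "{0}" 1] 2
  show "cdim c = 2" "ce c {} 0 = ce d {} 0" "ce c {} 1 = ce d {} 1"
    "ce c {1} 0 = ce d {1} 0" "ce c {0} 1 = ce d {0} 1"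
    by auto
qed

lemma has_cube_subcube:
  assumes "dcomplex X" "c \<in> cubes X" "A \<subseteq> {..<cdim c}" "inj_on g {..<k}"
    "g ` {..<k} \<subseteq> {..<cdim c} - A"
  shows "has_cube X (subcube c A k g)"
  using assms unfolding dcomplex_def by blast

lemma square_has_cube:
  assumes "has_cube X c" "cdim c = 2"
  shows "square X (ce c {} 0) (ce c {} 1) (ce c {1} 0) (ce c {0} 1)"
proof -
  obtain d where d: "d \<in> cubes X" "same_cube c d" using assms unfolding has_cube_def by blast
  then have "cdim d = 2" using assms by (simp add: same_cube_def)
  with same_square_edges[OF d(2)] d(1) show ?thesis
    unfolding square_def by metis
qed

lemma square_sym:
  assumes "dcomplex X" "square X a b a' b'"
  shows "square X b a b' a'"
proof -
  obtain c where c: "c \<in> cubes X" "cdim c = 2" and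
    e: "a = ce c {} 0" "b = ce c {} 1" "a' = ce c {1} 0" "b' = ce c {0} 1"
    using assms(2) unfolding square_def by blast
  \<comment> \<open>On \<open>{..<2}\<close> the truncated subtraction exchanges 0 and 1, so
    \<open>?d\<close> is the same square with its coordinates swapped.\<close>
  let ?g = "\<lambda>i. 1 - i :: nat"
  let ?d = "subcube c {} 2 ?g"
  have "has_cube X ?d"
    using c(2) by (intro has_cube_subcube assms(1) c(1)) (auto simp: inj_on_def)
  moreover have "cdim ?d = 2" by (simp add: subcube_def cdim_def)
  ultimately have "square X (ce ?d {} 0) (ce ?d {} 1) (ce ?d {1} 0) (ce ?d {0} 1)"
    by (rule square_has_cube)
  then show ?thesis by (simp add: e subcube_def ce_def)
qed

lemma path_move_end:
  assumes "dcomplex X" "path_move X u p q"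
  shows "path_end X u p = path_end X u q"
proof -
  obtain x m m' y where pq: "p = x @ m @ y" "q = x @ m' @ y" "base_move X m m'"
    and p: "path_from X u p" "path_from X u q"
    using assms(2) unfolding path_move_def by blast
  have "path_end X (path_end X u x) m = path_end X (path_end X u x) m'"
    using pq(3) unfolding base_move_iff
  proof (elim disjE exE conjE)
    fix e b assume m: "m = [(e, b), (e, \<not> b)]" "m' = []"
    then show ?thesis using p(1) unfolding pq by (auto simp: step_src_def step_tgt_def)
  next
    fix a b a' b' assume "square X a b a' b'" "m = [(a, True), (b', True)]" "m' = [(b, True), (a', True)]"
    then show ?thesis using square_edges[OF assms(1)] by (auto simp: step_tgt_def)
  qed
  then show ?thesis by (simp add: pq)
qed

section \<open>Homotopy of edge paths\<close>

lemma homotopic_refl [simp]: "homotopic X u p p"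
  by (simp add: homotopic_def)

lemma homotopic_sym: "homotopic X u p q \<Longrightarrow> homotopic X u q p"
  unfolding homotopic_def by (rule sympD[OF symp_rtranclp]) (auto intro: sympI)

lemma homotopic_trans: "homotopic X u p q \<Longrightarrow> homotopic X u q r \<Longrightarrow> homotopic X u p r"
  unfolding homotopic_def by (rule rtranclp_trans)

lemma homotopic_move: "path_move X u p q \<Longrightarrow> homotopic X u p q"
  unfolding homotopic_def by auto

lemma homotopic_mono:
  assumes "homotopic X u p q"
    and "\<And>p q. path_move X u p q \<Longrightarrow> homotopic Z v (g p) (g q)"
  shows "homotopic Z v (g p) (g q)"
  using assms(1) unfolding homotopic_def[of X u]
proof (induction rule: rtranclp_induct)
  case (step q r)
  then show ?case using assms(2) by (blast intro: homotopic_trans homotopic_sym)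
qed simp

lemma homotopic_cong:
  assumes "homotopic X u p q"
    and "\<And>p q. path_move X u p q \<Longrightarrow> w p = w q"
  shows "w p = w q"
  using assms(1) unfolding homotopic_def
  by (induction rule: rtranclp_induct) (use assms(2) in auto)

lemma homotopic_end:
  assumes "dcomplex X" "homotopic X u p q"
  shows "path_end X u p = path_end X u q"
  using homotopic_cong[OF assms(2), where w = "path_end X u"] path_move_end[OF assms(1)] by blast

lemma homotopic_path_from:
  assumes "homotopic X u p q"
  shows "path_from X u p = path_from X u q"
  by (rule homotopic_cong[OF assms]) (simp add: path_move_def)

lemma path_moveI:
  assumes "base_move X m m'" "path_from X u (x @ m @ y)" "path_from X u (x @ m' @ y)"
  shows "path_move X u (x @ m @ y) (x @ m' @ y)"
  using assms unfolding path_move_def by blast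

lemma path_moveE:
  assumes "path_move X u p q"
  obtains x m m' y where "p = x @ m @ y" "q = x @ m' @ y" "base_move X m m'"
    "path_from X u p" "path_from X u q"
  using assms unfolding path_move_def by blast

lemma path_move_append_right:
  assumes "dcomplex X" "path_move X u p q" "path_from X (path_end X u p) r"
  shows "path_move X u (p @ r) (q @ r)"
proof -
  obtain x m m' y where pq: "p = x @ m @ y" "q = x @ m' @ y" "base_move X m m'"
    "path_from X u p" "path_from X u q"
    using assms(2) by (rule path_moveE)
  have "path_from X u (p @ r)" "path_from X u (q @ r)"
    using pq(4,5) assms(3) path_move_end[OF assms(1,2)] by simp_all
  then show ?thesis using path_moveI[OF pq(3), where x = x and y = "y @ r"] unfolding pq by simp
qed

lemma path_move_append_left:
  assumes "path_from X u p" "path_move X (path_end X u p) q r"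
  shows "path_move X u (p @ q) (p @ r)"
proof -
  obtain x m m' y where pq: "q = x @ m @ y" "r = x @ m' @ y" "base_move X m m'"
    "path_from X (path_end X u p) q" "path_from X (path_end X u p) r"
    using assms(2) by (rule path_moveE)
  have "path_from X u (p @ q)" "path_from X u (p @ r)"
    using pq(4,5) assms(1) by simp_all
  then show ?thesis using path_moveI[OF pq(3), where x = "p @ x" and y = y] unfolding pq by simp
qed

text \<open>\<open>homotopic_mono\<close> does not apply: \<open>r\<close> can be appended to a move
  only if the moved paths end where \<open>r\<close> starts, which is known only along the given
  chain of moves.\<close>

lemma homotopic_append_right:
  assumes "dcomplex X" "homotopic X u p q" "path_from X (path_end X u p) r"
  shows "homotopic X u (p @ r) (q @ r)"
proof -
  have "(\<lambda>p q. path_move X u p q \<or> path_move X u q p)\<^sup>*\<^sup>* p q"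
    using assms(2) unfolding homotopic_def .
  then show ?thesis using assms(3)
  proof (induction rule: rtranclp_induct)
    case (step q q')
    have "path_end X u q = path_end X u p"
      by (rule homotopic_end[OF assms(1), symmetric]) (simp add: homotopic_def step.hyps(1))
    moreover have "path_end X u q' = path_end X u q"
      using step.hyps(2) by (auto dest: path_move_end[OF assms(1)])
    ultimately have r: "path_from X (path_end X u q) r" "path_from X (path_end X u q') r"
      using step.prems by simp_all
    have "path_move X u (q @ r) (q' @ r) \<or> path_move X u (q' @ r) (q @ r)"
      using step.hyps(2) r by (blast intro: path_move_append_right[OF assms(1)])
    then have "homotopic X u (q @ r) (q' @ r)"
      by (auto intro: homotopic_move homotopic_sym)
    then show ?case by (rule homotopic_trans[OF step.IH[OF step.prems]])
  qed simp
qed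

lemma homotopic_append_left:
  assumes "path_from X u p" "homotopic X (path_end X u p) q r"
  shows "homotopic X u (p @ q) (p @ r)"
  using assms(2)
  by (rule homotopic_mono[where g = "\<lambda>q. p @ q"])
    (blast intro: homotopic_move path_move_append_left assms(1))

section \<open>Inverse paths, cancellation and the order of the filter\<close>

definition rev_path :: "('e \<times> bool) list \<Rightarrow> ('e \<times> bool) list" where
  "rev_path p = rev (map (\<lambda>(e, b). (e, \<not> b)) p)"

lemma path_from_rev_path:
  "path_from X u p \<Longrightarrow> path_from X (path_end X u p) (rev_path p) \<and>
     path_end X (path_end X u p) (rev_path p) = u"
  by (induction p arbitrary: u) (auto simp: rev_path_def step_src_def step_tgt_def)

lemma homotopic_rev_path:
  assumes "path_from X u (p @ r)"
  shows "homotopic X (path_end X u p) (rev_path p @ p @ r) r"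
  using assms
proof (induction p arbitrary: u)
  case (Cons s p)
  obtain e b where s: "s = (e, b)" by force
  let ?v = "path_end X (step_tgt X s) p"
  have p: "path_from X (step_tgt X s) p" using Cons.prems by auto
  note q = path_from_rev_path[OF p]
  have "path_move X ?v (rev_path p @ [(e, \<not> b), (e, b)] @ (p @ r)) (rev_path p @ (p @ r))"
    unfolding path_move_def
  proof (intro conjI exI)
    show "base_move X [(e, \<not> b), (e, b)] []"
      unfolding base_move_def by (rule disjI1, rule exI[of _ e], rule exI[of _ "\<not> b"]) simp
  qed (use Cons.prems q s in \<open>auto simp: step_src_def step_tgt_def\<close>)
  moreover have "rev_path (s # p) = rev_path p @ [(e, \<not> b)]" by (simp add: rev_path_def s)
  ultimately have "homotopic X ?v (rev_path (s # p) @ (s # p) @ r) (rev_path p @ p @ r)"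
    using homotopic_move by (simp add: s)
  moreover have "homotopic X ?v (rev_path p @ p @ r) r"
    using Cons by auto
  ultimately show ?case using homotopic_trans by fastforce
qed (simp add: rev_path_def)

text \<open>Prefixing the inverse of \<open>p\<close> undoes \<open>p\<close>. Hence homotopy of
  extensions depends on a common prefix only through its endpoint.\<close>

lemma homotopic_cancel_left:
  assumes "path_from X u (p @ q)" "homotopic X u (p @ q) (p @ r)"
  shows "homotopic X (path_end X u p) q r"
proof -
  let ?v = "path_end X u p" and ?i = "rev_path p"
  have r: "path_from X u (p @ r)" using assms(1) homotopic_path_from[OF assms(2)] by simp
  have i: "path_from X ?v ?i" "path_end X ?v ?i = u"
    using path_from_rev_path[of X u p] assms(1) by simp_all
  have "homotopic X ?v (?i @ p @ q) (?i @ p @ r)"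
    using homotopic_append_left[OF i(1), of "p @ q" "p @ r"] assms(2) i(2) by simp
  with homotopic_sym[OF homotopic_rev_path[OF assms(1)]] have "homotopic X ?v q (?i @ p @ r)"
    by (rule homotopic_trans)
  then show ?thesis using homotopic_rev_path[OF r] by (rule homotopic_trans)
qed

text \<open>In \<open>pf_le\<close> the extension starts from some representative of the class of
  \<open>p\<close>. Appending a path respects homotopy, so \<open>p\<close> itself serves.\<close>

lemma pf_le_hclass:
  assumes X: "dcomplex X" and p: "path_from X u p" and q: "path_from X u q"
  shows "pf_le (hclass X u p) (hclass X u q) \<longleftrightarrow>
    (\<exists>r. directed_path r \<and> path_from X u (p @ r) \<and> homotopic X u (p @ r) q)"
proof
  assume "pf_le (hclass X u p) (hclass X u q)"
  then obtain p' r where r: "directed_path r" "path_from X u p'" "homotopic X u p p'"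
    "path_from X u (p' @ r)" "homotopic X u q (p' @ r)"
    unfolding pf_le_def hclass_def by blast
  have "path_from X (path_end X u p) r" using r homotopic_end[OF X r(3)] by simp
  then have "homotopic X u (p @ r) (p' @ r)" using r by (intro homotopic_append_right[OF X]) auto
  then show "\<exists>r. directed_path r \<and> path_from X u (p @ r) \<and> homotopic X u (p @ r) q"
    using r p \<open>path_from X (path_end X u p) r\<close>
    by (intro exI[of _ r]) (auto intro: homotopic_trans homotopic_sym)
next
  assume "\<exists>r. directed_path r \<and> path_from X u (p @ r) \<and> homotopic X u (p @ r) q"
  then show "pf_le (hclass X u p) (hclass X u q)"
    unfolding pf_le_def hclass_def using p homotopic_sym by fastforce
qed

subsection \<open>Homotopy invariants\<close>

text \<open>Evaluation of a 1-cochain on a path; the sign makes backtracking contribute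
  zero.\<close>

definition weight :: "('e \<Rightarrow> int) \<Rightarrow> ('e \<times> bool) list \<Rightarrow> int" where
  "weight g p = (\<Sum>s\<leftarrow>p. if snd s then g (fst s) else - g (fst s))"

lemma weight_simps [simp]:
  "weight g [] = 0"
  "weight g (s # p) = (if snd s then g (fst s) else - g (fst s)) + weight g p"
  "weight g (p @ q) = weight g p + weight g q"
  by (simp_all add: weight_def)

lemma homotopic_weight:
  assumes "homotopic X u p q"
    and "\<And>a b a' b'. square X a b a' b' \<Longrightarrow> g a = g a' \<and> g b = g b'"
  shows "weight g p = weight g q"
proof (rule homotopic_cong[OF assms(1)])
  fix p q assume "path_move X u p q"
  then obtain x m m' y where pq: "p = x @ m @ y" "q = x @ m' @ y" "base_move X m m'"
    unfolding path_move_def by blast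
  then have "weight g m = weight g m'"
    unfolding base_move_iff using assms(2) by fastforce
  then show "weight g p = weight g q" by (simp add: pq)
qed

lemma weight_one: "directed_path p \<Longrightarrow> weight (\<lambda>_. 1) p = int (length p)"
  by (induction p) auto

text \<open>The constant cochain 1 is invariant and measures the length of directed paths, even if
  the homotopy between them runs through undirected ones.\<close>

lemma homotopic_length:
  assumes "homotopic X u p q" "directed_path p" "directed_path q"
  shows "length p = length q"
  using homotopic_weight[OF assms(1), of "\<lambda>_. 1"] assms(2,3) by (simp add: weight_one)

text \<open>The direction of a step is ignored, so backtracking acts trivially exactly when each
  \<open>t e\<close> is an involution. This suits a Coxeter group, and three points already suffice
  to separate noncommuting generators.\<close>

definition act :: "('e \<Rightarrow> nat \<Rightarrow> nat) \<Rightarrow> ('e \<times> bool) list \<Rightarrow> nat \<Rightarrow> nat" where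
  "act t p = fold (\<lambda>s. t (fst s)) p"

lemma homotopic_act:
  assumes "homotopic X u p q"
    and inv: "\<And>e n. t e (t e n) = n"
    and sq: "\<And>a b a' b' n. square X a b a' b' \<Longrightarrow> t b' (t a n) = t a' (t b n)"
  shows "act t p = act t q"
proof (rule homotopic_cong[OF assms(1)])
  fix p q assume "path_move X u p q"
  then obtain x m m' y where pq: "p = x @ m @ y" "q = x @ m' @ y" "base_move X m m'"
    unfolding path_move_def by blast
  then have "act t m = act t m'"
    unfolding base_move_iff using inv sq by (auto simp: act_def fun_eq_iff)
  then show "act t p = act t q" by (simp add: pq act_def)
qed

subsection \<open>Configurations\<close>

locale prime_event_structure =
  fixes E :: "'a set" and le cf :: "'a \<Rightarrow> 'a \<Rightarrow> bool"
  assumes es: "event_structure E le cf"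
begin

abbreviation "Conf \<equiv> configurations E le cf"

definition below :: "'a \<Rightarrow> 'a set" where
  "below e = {x \<in> E. le x e \<and> x \<noteq> e}"

lemma le_refl: "e \<in> E \<Longrightarrow> le e e"
  and le_antisym: "e \<in> E \<Longrightarrow> e' \<in> E \<Longrightarrow> le e e' \<Longrightarrow> le e' e \<Longrightarrow> e = e'"
  and le_trans: "e \<in> E \<Longrightarrow> e' \<in> E \<Longrightarrow> e'' \<in> E \<Longrightarrow> le e e' \<Longrightarrow> le e' e'' \<Longrightarrow> le e e''"
  and finite_down: "e \<in> E \<Longrightarrow> finite {x \<in> E. le x e}"
  and cf_irrefl: "e \<in> E \<Longrightarrow> \<not> cf e e"
  and cf_sym: "e \<in> E \<Longrightarrow> e' \<in> E \<Longrightarrow> cf e e' \<Longrightarrow> cf e' e"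
  and cf_inherit: "e \<in> E \<Longrightarrow> e' \<in> E \<Longrightarrow> e'' \<in> E \<Longrightarrow> cf e e' \<Longrightarrow> le e' e'' \<Longrightarrow> cf e e''"
  using es unfolding event_structure_def by blast+

lemma cf_inherit2:
  assumes "x \<in> E" "y \<in> E" "e \<in> E" "e' \<in> E" "le x e" "le y e'" "cf x y"
  shows "cf e e'"
  using assms cf_inherit[of x y e'] cf_inherit[of e' x e] cf_sym[of x e'] cf_sym[of e' e] by simp

lemma le_self_not_cf:
  assumes "x \<in> E" "y \<in> E" "e \<in> E" "le x e" "le y e"
  shows "\<not> cf x y"
  using cf_inherit2[of x y e e] cf_irrefl assms by blast

lemma confD:
  assumes "c \<in> Conf"
  shows "c \<subseteq> E" "finite c"
    and "\<And>x y. x \<in> c \<Longrightarrow> y \<in> c \<Longrightarrow> \<not> cf x y"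
    and "\<And>x y. x \<in> c \<Longrightarrow> y \<in> E \<Longrightarrow> le y x \<Longrightarrow> y \<in> c"
  using assms unfolding configurations_def by blast+

lemma confI:
  assumes "c \<subseteq> E" "finite c"
    and "\<And>x y. x \<in> c \<Longrightarrow> y \<in> c \<Longrightarrow> \<not> cf x y"
    and "\<And>x y. x \<in> c \<Longrightarrow> y \<in> E \<Longrightarrow> le y x \<Longrightarrow> y \<in> c"
  shows "c \<in> Conf"
  using assms unfolding configurations_def by blast

lemma below_conf:
  assumes "e \<in> E"
  shows "below e \<in> Conf"
proof (rule confI)
  show "finite (below e)"
    using finite_down[OF assms] by (rule rev_finite_subset) (auto simp: below_def)
  show "\<not> cf x y" if "x \<in> below e" "y \<in> below e" for x y
    using that le_self_not_cf[of x y e] assms by (auto simp: below_def)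
  show "y \<in> below e" if "x \<in> below e" "y \<in> E" "le y x" for x y
    using that le_trans[of y x e] le_antisym[of x e] assms by (auto simp: below_def)
qed (auto simp: below_def)

lemma conf_Un:
  assumes c: "c \<in> Conf" and d: "d \<in> Conf"
    and cf: "\<And>x y. x \<in> c \<Longrightarrow> y \<in> d \<Longrightarrow> \<not> cf x y"
  shows "c \<union> d \<in> Conf"
proof (rule confI)
  show "\<not> cf x y" if "x \<in> c \<union> d" "y \<in> c \<union> d" for x y
    using that cf confD(3)[OF c] confD(3)[OF d] cf_sym[of x y] confD(1)[OF c] confD(1)[OF d]
    by blast
  show "y \<in> c \<union> d" if "x \<in> c \<union> d" "y \<in> E" "le y x" for x y
    using that confD(4)[OF c] confD(4)[OF d] by blast
qed (use confD(1,2)[OF c] confD(1,2)[OF d] in auto)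

lemma conf_insert:
  assumes c: "c \<in> Conf" and e: "e \<in> E" and sub: "below e \<subseteq> c"
    and cf: "\<And>x. x \<in> c \<Longrightarrow> \<not> cf x e"
  shows "insert e c \<in> Conf"
proof (rule confI)
  show "\<not> cf x y" if "x \<in> insert e c" "y \<in> insert e c" for x y
    using that cf confD(3)[OF c] cf_sym[of x y] cf_irrefl[OF e] e confD(1)[OF c] by blast
  show "y \<in> insert e c" if "x \<in> insert e c" "y \<in> E" "le y x" for x y
    using that sub confD(4)[OF c] unfolding below_def by blast
qed (use confD(1,2)[OF c] e in auto)

lemma below_subset:
  assumes "insert e c \<in> Conf"
  shows "below e \<subseteq> c"
  using confD(4)[OF assms] unfolding below_def by blast

lemma conf_remove:
  assumes c: "c \<in> Conf" and max: "\<And>y. y \<in> c \<Longrightarrow> le x y \<Longrightarrow> y = x"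
  shows "c - {x} \<in> Conf"
proof (rule confI)
  show "z \<in> c - {x}" if "y \<in> c - {x}" "z \<in> E" "le z y" for y z
    using that max[of y] confD(4)[OF c] by blast
  show "\<not> cf y z" if "y \<in> c - {x}" "z \<in> c - {x}" for y z
    using that confD(3)[OF c] by blast
qed (use confD(1,2)[OF c] in auto)

lemma max_element:
  assumes "finite A" "A \<noteq> {}" "A \<subseteq> E"
  shows "\<exists>x\<in>A. \<forall>y\<in>A. le x y \<longrightarrow> y = x"
  using assms
proof (induction rule: finite_ne_induct)
  case (insert a A)
  then obtain x where x: "x \<in> A" "\<forall>y\<in>A. le x y \<longrightarrow> y = x" by auto
  show ?case
  proof (cases "le x a")
    case True
    then have "\<forall>y\<in>A. le a y \<longrightarrow> y = a"
      using x insert.prems le_trans[of x a] le_antisym[of x a] by blast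
    then show ?thesis by blast
  qed (use x in auto)
qed auto

lemma min_element:
  assumes "finite A" "A \<noteq> {}" "A \<subseteq> E"
  shows "\<exists>x\<in>A. \<forall>y\<in>A. le y x \<longrightarrow> y = x"
  using assms
proof (induction rule: finite_ne_induct)
  case (insert a A)
  then obtain x where x: "x \<in> A" "\<forall>y\<in>A. le y x \<longrightarrow> y = x" by auto
  show ?case
  proof (cases "le a x")
    case True
    then have "\<forall>y\<in>A. le y a \<longrightarrow> y = a"
      using x insert.prems le_trans[of _ a x] le_antisym[of x a] by blast
    then show ?thesis by blast
  qed (use x in auto)
qed auto

text \<open>A minimal event of \<open>d - c\<close> has its whole strict past in \<open>c\<close>.
  So every proper inclusion of configurations begins with the addition of a single event.\<close>

lemma conf_next:
  assumes c: "c \<in> Conf" and d: "d \<in> Conf" and "c \<subset> d"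
  shows "\<exists>e. e \<in> d - c \<and> insert e c \<in> Conf"
proof -
  have "finite (d - c)" "d - c \<noteq> {}" "d - c \<subseteq> E"
    using assms confD(1,2)[OF d] by auto
  from min_element[OF this] obtain e where e: "e \<in> d - c" "\<forall>y\<in>d - c. le y e \<longrightarrow> y = e" by blast
  then have "below e \<subseteq> c" using confD(4)[OF d, of e] unfolding below_def by blast
  moreover have "\<not> cf x e" if "x \<in> c" for x using confD(3)[OF d] that e assms(3) by blast
  ultimately have "insert e c \<in> Conf"
    using e confD(1)[OF d] by (intro conf_insert c) auto
  then show ?thesis using e by blast
qed

end

subsection \<open>Labelled domains\<close>

text \<open>In a special complex, L sends an edge to its hyperplane and I is crossing of hyperplanes.\<close>

locale labelled_complex =
  fixes X :: "('v, 'e, 'z) dcomplex_scheme" and L :: "'e \<Rightarrow> nat" and I :: "nat \<Rightarrow> nat \<Rightarrow> bool"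
  assumes dcomplex: "dcomplex X"
    and square_label: "square X a b a' b' \<Longrightarrow> L a = L a' \<and> L b = L b' \<and> I (L a) (L b)"
    and I_sym: "I k l \<Longrightarrow> I l k"
    and I_irrefl: "\<not> I k k"
    and I_labels: "I k l \<Longrightarrow> k \<in> L ` edges X"
    and deterministic: "a \<in> edges X \<Longrightarrow> b \<in> edges X \<Longrightarrow> src X a = src X b \<Longrightarrow> L a = L b \<Longrightarrow> a = b"
    and fork: "a \<in> edges X \<Longrightarrow> b \<in> edges X \<Longrightarrow> src X a = src X b \<Longrightarrow> I (L a) (L b) \<Longrightarrow>
      \<exists>a' b'. square X a b a' b'"
    and chain: "a \<in> edges X \<Longrightarrow> b' \<in> edges X \<Longrightarrow> tgt X a = src X b' \<Longrightarrow> I (L a) (L b') \<Longrightarrow>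
      \<exists>b a'. square X a b a' b'"
begin

lemma homotopic_label_weight:
  "homotopic X u p q \<Longrightarrow>
    weight (\<lambda>e. if L e = k then 1 else 0) p = weight (\<lambda>e. if L e = k then 1 else 0) q"
  by (erule homotopic_weight) (drule square_label, simp)

lemma homotopic_square:
  assumes "square X a b a' b'" "path_from X u p" "path_end X u p = src X a"
  shows "path_from X u (p @ [(a, True), (b', True)])" "path_from X u (p @ [(b, True), (a', True)])"
    "homotopic X u (p @ [(a, True), (b', True)]) (p @ [(b, True), (a', True)])"
proof -
  note e = square_edges[OF dcomplex assms(1)]
  show p: "path_from X u (p @ [(a, True), (b', True)])"
    "path_from X u (p @ [(b, True), (a', True)])"
    using assms e by (auto simp: step_src_def step_tgt_def)
  have "base_move X [(a, True), (b', True)] [(b, True), (a', True)]"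
    using assms(1) unfolding base_move_iff by blast
  from path_moveI[OF this, where x = p and y = "[]"] p
  show "homotopic X u (p @ [(a, True), (b', True)]) (p @ [(b, True), (a', True)])"
    by (intro homotopic_move) simp
qed

text \<open>Noncommuting labels are detected by letting them act on three points as two transpositions
  that share a point.\<close>

lemma independent_if_commute:
  assumes hom: "homotopic X v [(a, True), (b', True)] [(b, True), (a', True)]"
    and L: "L a = L a'" "L b = L b'" "L a \<noteq> L b"
  shows "I (L a) (L b)"
proof (rule ccontr)
  assume nI: "\<not> I (L a) (L b)"
  define sw where "sw i j n = (if n = i then j else if n = j then i else n)" for i j n :: nat
  define t where "t e = (if L e = L a then sw 0 1 else if L e = L b then sw 1 2 else id)" for e
  have "act t [(a, True), (b', True)] = act t [(b, True), (a', True)]"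
    using hom
  proof (rule homotopic_act)
    show "t e (t e n) = n" for e n by (auto simp: t_def sw_def)
    fix c d c' d' n assume "square X c d c' d'"
    then have s: "L c = L c'" "L d = L d'" "I (L c) (L d)" "I (L d) (L c)"
      using square_label I_sym by blast+
    then have "\<not> (L c = L a \<and> L d = L b)" "\<not> (L d = L a \<and> L c = L b)" "L c \<noteq> L d"
      using nI I_irrefl by auto
    then show "t d' (t c n) = t c' (t d n)"
      using s(1,2) by (auto simp: t_def)
  qed
  then have "t b' (t a 0) = t a' (t b 0)" by (simp add: act_def fun_eq_iff)
  then show False using L by (auto simp: t_def sw_def)
qed

end

text \<open>\<open>F\<close> names configurations by directed paths from \<open>u\<close>, so that
  no homotopy classes have to be handled. That it factors through homotopy is a consequence of the
  order condition (\<open>F_eq\<close>).\<close>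

locale labelled_domain = labelled_complex X L I + prime_event_structure E le cf
  for X :: "('v, 'e, 'z) dcomplex_scheme" and L I and E :: "'a set" and le cf +
  fixes u :: 'v and F :: "('e \<times> bool) list \<Rightarrow> 'a set"
  assumes u: "u \<in> verts X"
    and F_image: "F ` {p. path_from X u p \<and> directed_path p} = configurations E le cf"
    and F_subset_iff: "path_from X u p \<Longrightarrow> directed_path p \<Longrightarrow> path_from X u q \<Longrightarrow> directed_path q \<Longrightarrow>
      F p \<subseteq> F q \<longleftrightarrow> (\<exists>r. directed_path r \<and> path_from X u (p @ r) \<and> homotopic X u (p @ r) q)"
begin

section \<open>Directed paths as names of configurations\<close>

definition dpath :: "('e \<times> bool) list \<Rightarrow> bool" where
  "dpath p \<longleftrightarrow> path_from X u p \<and> directed_path p"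

lemma dpath_appendD: "dpath (p @ q) \<Longrightarrow> dpath p"
  by (simp add: dpath_def)

lemma dpath_snoc:
  "dpath (p @ [(s, True)]) \<longleftrightarrow> dpath p \<and> s \<in> edges X \<and> src X s = path_end X u p"
  by (auto simp: dpath_def step_src_def)

lemma F_conf: "dpath p \<Longrightarrow> F p \<in> Conf"
  using F_image by (auto simp: dpath_def)

lemma conf_F: "c \<in> Conf \<Longrightarrow> \<exists>p. dpath p \<and> F p = c"
  unfolding F_image[symmetric] by (auto simp: dpath_def)

lemma F_subset:
  "dpath p \<Longrightarrow> dpath q \<Longrightarrow> F p \<subseteq> F q \<longleftrightarrow> (\<exists>r. dpath (p @ r) \<and> homotopic X u (p @ r) q)"
  using F_subset_iff[of p q] by (auto simp: dpath_def)

lemma dpath_length: "dpath p \<Longrightarrow> dpath q \<Longrightarrow> homotopic X u p q \<Longrightarrow> length p = length q"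
  using homotopic_length by (auto simp: dpath_def)

text \<open>Mutual inclusion gives extensions in both directions. Homotopic directed paths have
  equal length, so both extensions are empty.\<close>

lemma F_eq:
  assumes p: "dpath p" and q: "dpath q"
  shows "F p = F q \<longleftrightarrow> homotopic X u p q"
proof
  assume "F p = F q"
  then obtain r s where r: "dpath (p @ r)" "homotopic X u (p @ r) q"
    and s: "dpath (q @ s)" "homotopic X u (q @ s) p"
    using F_subset[OF p q] F_subset[OF q p] by blast
  from dpath_length[OF r(1) q r(2)] dpath_length[OF s(1) p s(2)] have "length r = 0"
    unfolding length_append by linarith
  then have "r = []" by simp
  then show "homotopic X u p q" using r(2) by simp
next
  assume h: "homotopic X u p q"
  have "\<exists>r. dpath (p @ r) \<and> homotopic X u (p @ r) q"
    using h p by (intro exI[of _ "[]"]) simp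
  moreover have "\<exists>r. dpath (q @ r) \<and> homotopic X u (q @ r) p"
    using homotopic_sym[OF h] q by (intro exI[of _ "[]"]) simp
  ultimately show "F p = F q" using F_subset[OF p q] F_subset[OF q p] by blast
qed

text \<open>Every edge strictly enlarges the configuration, and nothing lies strictly between
  \<open>F p\<close> and \<open>insert e (F p)\<close>. So the first edge of a path leading there
  already reaches it.\<close>

lemma F_step:
  assumes p: "dpath p" and e: "e \<notin> F p" "insert e (F p) \<in> Conf"
  obtains s where "dpath (p @ [(s, True)])" "F (p @ [(s, True)]) = insert e (F p)"
proof -
  obtain q where q: "dpath q" "F q = insert e (F p)" using conf_F[OF e(2)] by blast
  then obtain r where r: "dpath (p @ r)" "homotopic X u (p @ r) q"
    using F_subset[OF p q(1)] by blast
  then have Fr: "F (p @ r) = insert e (F p)" using F_eq q by blast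
  then obtain s r' where sr: "r = s # r'" using e by (cases r) auto
  then obtain s' where s': "s = (s', True)" using r(1) by (cases s) (auto simp: dpath_def)
  have d: "dpath (p @ [s])" using r(1) by (simp add: sr dpath_def)
  have "dpath (p @ [s] @ r')" using r(1) by (simp add: sr)
  then have "F (p @ [s]) \<subseteq> F (p @ r)"
    unfolding F_subset[OF d r(1)] by (intro exI[of _ r']) (simp add: sr)
  moreover have "F p \<subseteq> F (p @ [s])"
    unfolding F_subset[OF p d] using d by (intro exI[of _ "[s]"]) simp
  moreover have "F p \<noteq> F (p @ [s])"
    using F_eq[OF p d] dpath_length[OF p d] by auto
  ultimately have "F (p @ [s]) = insert e (F p)" unfolding Fr by blast
  then show ?thesis using that d s' by simp
qed

text \<open>Some single event can be added below the larger configuration, and \<open>F_step\<close>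
  provides an edge for it. By length, no further edge can follow, so this event accounts for all of
  the step.\<close>

lemma F_extend:
  assumes ps: "dpath (p @ [(s, True)])"
  obtains e where "e \<notin> F p" "e \<in> E" "F (p @ [(s, True)]) = insert e (F p)"
proof -
  have p: "dpath p" using ps by (rule dpath_appendD)
  have "F p \<subseteq> F (p @ [(s, True)])"
    unfolding F_subset[OF p ps] using ps by (intro exI[of _ "[(s, True)]"]) simp
  moreover have "F p \<noteq> F (p @ [(s, True)])"
    using F_eq[OF p ps] dpath_length[OF p ps] by auto
  ultimately obtain e where e: "e \<in> F (p @ [(s, True)]) - F p" "insert e (F p) \<in> Conf"
    using conf_next[OF F_conf[OF p] F_conf[OF ps]] by blast
  then obtain t where t: "dpath (p @ [(t, True)])" "F (p @ [(t, True)]) = insert e (F p)"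
    using F_step[OF p] by blast
  have "F (p @ [(t, True)]) \<subseteq> F (p @ [(s, True)])" unfolding t(2) using e(1) \<open>F p \<subseteq> _\<close> by blast
  then obtain r where r: "dpath ((p @ [(t, True)]) @ r)"
      "homotopic X u ((p @ [(t, True)]) @ r) (p @ [(s, True)])"
    using F_subset[OF t(1) ps] by blast
  from dpath_length[OF r(1) ps r(2)] have "r = []" by simp
  then have "F (p @ [(s, True)]) = insert e (F p)" using r F_eq[OF t(1) ps] t(2) by simp
  moreover have "e \<in> E" using e(2) confD(1) by blast
  ultimately show ?thesis using that e(1) by blast
qed

section \<open>Labels of steps and events\<close>

lemma step_label_unique:
  assumes "dpath (p @ [(s, True)])" "dpath (q @ [(t, True)])"
    and "F p = F q" "F (p @ [(s, True)]) = F (q @ [(t, True)])"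
  shows "L s = L t"
proof -
  have "homotopic X u p q" "homotopic X u (p @ [(s, True)]) (q @ [(t, True)])"
    using assms F_eq dpath_appendD by blast+
  \<comment> \<open>The prefixes contain \<open>L s\<close> equally often, so the last edges must do
    so as well.\<close>
  from this[THEN homotopic_label_weight, of "L s"] show ?thesis
    by (auto split: if_splits)
qed

text \<open>The place where concurrency is turned into independence: firing \<open>e\<close> and
  \<open>x\<close> in either order yields homotopic paths, whose label counts and label actions must
  agree.\<close>

lemma diamond:
  assumes p: "dpath p" and ne: "e \<noteq> x" "e \<notin> F p" "x \<notin> F p"
    and C: "insert e (F p) \<in> Conf" "insert x (F p) \<in> Conf" "insert x (insert e (F p)) \<in> Conf"
  obtains s t s' where
    "dpath (p @ [(s, True)])" "F (p @ [(s, True)]) = insert e (F p)"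
    "dpath (p @ [(t, True)])" "F (p @ [(t, True)]) = insert x (F p)"
    "dpath (p @ [(t, True)] @ [(s', True)])"
    "F (p @ [(t, True)] @ [(s', True)]) = insert e (insert x (F p))"
    "L s = L s'" "I (L s) (L t)"
proof -
  obtain s where s: "dpath (p @ [(s, True)])" "F (p @ [(s, True)]) = insert e (F p)"
    using F_step[OF p ne(2) C(1)] by blast
  obtain t where t: "dpath (p @ [(t, True)])" "F (p @ [(t, True)]) = insert x (F p)"
    using F_step[OF p ne(3) C(2)] by blast
  obtain t' where t': "dpath (p @ [(s, True), (t', True)])"
      "F (p @ [(s, True), (t', True)]) = insert x (insert e (F p))"
    using F_step[OF s(1), of x] s(2) ne C(3) by auto
  obtain s' where s': "dpath (p @ [(t, True), (s', True)])"
      "F (p @ [(t, True), (s', True)]) = insert e (insert x (F p))"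
    using F_step[OF t(1), of e] t(2) ne C(3) by (auto simp: insert_commute)
  have hom: "homotopic X u (p @ [(s, True), (t', True)]) (p @ [(t, True), (s', True)])"
    using F_eq[OF t'(1) s'(1)] t'(2) s'(2) by (simp add: insert_commute)
  have "s \<noteq> t" using s t ne by auto
  then have st: "L s \<noteq> L t" using deterministic[of s t] s(1) t(1) by (auto simp: dpath_snoc)
  \<comment> \<open>The prefix \<open>p\<close> counts equally on both sides. Since
    \<open>L s \<noteq> L t\<close>, the occurrence of \<open>L s\<close> on the left can be matched
    only by \<open>s'\<close>, and that of \<open>L t\<close> on the right only by
    \<open>t'\<close>.\<close>
  have Ls: "L s = L s'" "L t = L t'"
    using homotopic_label_weight[OF hom, of "L s"] homotopic_label_weight[OF hom, of "L t"] st
    by (auto split: if_splits)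
  have "path_from X u (p @ [(s, True), (t', True)])" using t'(1) by (simp add: dpath_def)
  from homotopic_cancel_left[OF this hom] have "I (L s) (L t)"
    by (rule independent_if_commute) (use Ls st in auto)
  then show ?thesis using that s t s' Ls by auto
qed

text \<open>The label is read off at the least configuration that enables \<open>e\<close>; by
  \<open>step_label_unique\<close> the choice of the path and of the edge is immaterial
  there.\<close>

definition lab :: "'a \<Rightarrow> nat" where
  "lab e = (SOME l. \<exists>p s. dpath (p @ [(s, True)]) \<and> F p = below e \<and>
     F (p @ [(s, True)]) = insert e (below e) \<and> l = L s)"

lemma insert_below_conf: "e \<in> E \<Longrightarrow> insert e (below e) \<in> Conf"
  using le_self_not_cf[of _ e e] le_refl by (intro conf_insert below_conf) (auto simp: below_def)

lemma lab_below:
  assumes "e \<in> E" "dpath (p @ [(s, True)])" "F p = below e" "F (p @ [(s, True)]) = insert e (below e)"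
  shows "L s = lab e"
proof -
  have "\<exists>q t. dpath (q @ [(t, True)]) \<and> F q = below e \<and>
     F (q @ [(t, True)]) = insert e (below e) \<and> lab e = L t"
    unfolding lab_def by (rule someI_ex) (use assms(2-4) in blast)
  then show ?thesis using step_label_unique assms(2-4) by metis
qed

text \<open>Removing the other events of the configuration one at a time moves the edge of e
  across squares, in which opposite edges carry equal labels.\<close>

lemma lab_step:
  assumes "dpath (p @ [(s, True)])" "F (p @ [(s, True)]) = insert e (F p)" "e \<notin> F p"
  shows "L s = lab e"
  using assms
proof (induction "card (F p - below e)" arbitrary: p s)
  case 0
  have p: "dpath p" using "0.prems"(1) by (rule dpath_appendD)
  have C: "insert e (F p) \<in> Conf" using F_conf[OF "0.prems"(1)] "0.prems"(2) by simp
  have "finite (F p)" using confD(2)[OF F_conf[OF p]] .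
  then have "F p = below e" using 0(1) below_subset[OF C] by auto
  moreover have "e \<in> E" using confD(1)[OF C] by simp
  ultimately show ?case using lab_below 0 by metis
next
  case (Suc n)
  have p: "dpath p" using Suc.prems(1) by (rule dpath_appendD)
  have c: "F p \<in> Conf" using p by (rule F_conf)
  have C: "insert e (F p) \<in> Conf" using F_conf[OF Suc.prems(1)] Suc.prems(2) by simp
  have sub: "below e \<subseteq> F p" using C by (rule below_subset)
  have e: "e \<in> E" using confD(1)[OF C] by simp
  note fin = confD(2)[OF c] and FE = confD(1)[OF c]
  have "F p - below e \<noteq> {}" using Suc(2) by (metis card.empty nat.distinct(1))
  with max_element[of "F p - below e"] fin FE obtain x
    where x: "x \<in> F p - below e" "\<forall>y\<in>F p - below e. le x y \<longrightarrow> y = x" by blast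
  \<comment> \<open>An event of \<open>below e\<close> above \<open>x\<close> would put
    \<open>x\<close> into the down-closed set \<open>below e\<close>. So \<open>x\<close> is maximal
    in all of \<open>F p\<close>, and its removal leaves a configuration.\<close>
  have max: "y = x" if "y \<in> F p" "le x y" for y
    using that x confD(4)[OF below_conf[OF e], of y x] FE by blast
  have xe: "x \<noteq> e" "\<not> le x e" using x Suc.prems(3) FE by (auto simp: below_def)
  define c' where "c' = F p - {x}"
  have c': "c' \<in> Conf" unfolding c'_def using c max by (rule conf_remove)
  have "insert e (F p) - {x} \<in> Conf" using C max xe by (intro conf_remove) auto
  then have C': "insert e c' \<in> Conf" unfolding c'_def using xe by (simp add: insert_Diff_if)
  obtain q where q: "dpath q" "F q = c'" using conf_F[OF c'] by blast
  have ins: "insert x c' = F p" using x unfolding c'_def by blast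
  have xc': "x \<notin> c'" and ec': "e \<notin> c'" using Suc.prems(3) unfolding c'_def by blast+
  have Cx: "insert x c' \<in> Conf" and Cxe: "insert x (insert e c') \<in> Conf"
    using c C ins by (simp_all add: insert_commute[of x e])
  obtain a t a' where d: "dpath (q @ [(a, True)])" "F (q @ [(a, True)]) = insert e c'"
    "dpath (q @ [(t, True)])" "F (q @ [(t, True)]) = insert x c'"
    "dpath (q @ [(t, True)] @ [(a', True)])"
    "F (q @ [(t, True)] @ [(a', True)]) = insert e (insert x c')"
    "L a = L a'" "I (L a) (L t)"
    by (rule diamond[OF q(1) xe(1)[symmetric], unfolded q(2), OF ec' xc' C' Cx Cxe])
  have "F q - below e = (F p - below e) - {x}" unfolding q(2) c'_def by blast
  then have "card (F q - below e) = n" using Suc(2) x fin by simp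
  then have "L a = lab e"
    using Suc(1)[of q a] d q(2) Suc.prems(3) unfolding c'_def by auto
  moreover have "L a' = L s"
    using step_label_unique[of "q @ [(t, True)]" a' p s] d Suc.prems ins by simp
  ultimately show ?case using d(7) by simp
qed

section \<open>The axioms of a trace labeling\<close>

definition labels :: "nat set" where
  "labels = L ` edges X"

lemma lab_in_labels:
  assumes "e \<in> E"
  shows "lab e \<in> labels"
proof -
  obtain p where p: "dpath p" "F p = below e" using conf_F[OF below_conf[OF assms]] by blast
  have ne: "e \<notin> below e" by (simp add: below_def)
  obtain s where s: "dpath (p @ [(s, True)])" "F (p @ [(s, True)]) = insert e (F p)"
    using F_step[OF p(1), of e] insert_below_conf[OF assms] ne p(2) by auto
  have "lab e = L s" using lab_step[OF s] ne p by simp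
  then show ?thesis using s(1) by (simp add: dpath_snoc labels_def)
qed

text \<open>The union of the two strict pasts works. The last hypothesis allows conflict only
  between \<open>e\<close> and \<open>e'\<close> themselves, so the lemma serves minimal conflict
  and concurrency alike.\<close>

lemma common_past:
  assumes e: "e \<in> E" "e' \<in> E" and nle: "\<not> le e e'" "\<not> le e' e"
    and ncf: "\<forall>x\<in>E. \<forall>y\<in>E. le x e \<and> le y e' \<and> cf x y \<longrightarrow> x = e \<and> y = e'"
  obtains c where "c \<in> Conf" "e \<notin> c" "e' \<notin> c" "insert e c \<in> Conf" "insert e' c \<in> Conf"
proof
  let ?c = "below e \<union> below e'"
  show c: "?c \<in> Conf"
    using e ncf by (intro conf_Un below_conf) (auto simp: below_def)
  show "e \<notin> ?c" "e' \<notin> ?c" using nle by (auto simp: below_def)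
  have "\<not> cf x e" if "x \<in> ?c" for x
  proof
    assume x: "cf x e"
    have xE: "x \<in> E" using that by (auto simp: below_def)
    have "le x e \<or> le x e' \<and> x \<noteq> e'" using that unfolding below_def by blast
    then consider "le x e" | "le x e'" "x \<noteq> e'" by blast
    then show False
    proof cases
      case 1
      then show ?thesis using x le_self_not_cf[of x e e] xE e le_refl by blast
    next
      case 2
      then show ?thesis using ncf x cf_sym[of x e] xE e le_refl by blast
    qed
  qed
  then show "insert e ?c \<in> Conf" using e c by (intro conf_insert) auto
  have "\<not> cf x e'" if "x \<in> ?c" for x
  proof
    assume x: "cf x e'"
    have xE: "x \<in> E" using that by (auto simp: below_def)
    have "le x e' \<or> le x e \<and> x \<noteq> e" using that unfolding below_def by blast
    then consider "le x e'" | "le x e" "x \<noteq> e" by blast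
    then show False
    proof cases
      case 1
      then show ?thesis using x le_self_not_cf[of x e' e'] xE e le_refl by blast
    next
      case 2
      then show ?thesis using ncf x xE e le_refl by blast
    qed
  qed
  then show "insert e' ?c \<in> Conf" using e c by (intro conf_insert) auto
qed

text \<open>Both events are enabled at a common vertex, where distinct edges have distinct labels.
  Independent labels would make the two edges span a square, and its far corner would be a
  configuration containing both events.\<close>

lemma min_conflict_labels:
  assumes "min_conflict E le cf e e'"
  shows "lab e \<noteq> lab e' \<and> \<not> I (lab e) (lab e')"
proof -
  have e: "e \<in> E" "e' \<in> E" and cf: "cf e e'"
    and m: "\<forall>x\<in>E. \<forall>y\<in>E. le x e \<and> le y e' \<and> cf x y \<longrightarrow> x = e \<and> y = e'"
    using assms unfolding min_conflict_def by blast+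
  have "\<not> le e e'" "\<not> le e' e"
    using le_self_not_cf[OF e] le_self_not_cf[OF e(1,2,1)] e cf le_refl by blast+
  from common_past[OF e this m] obtain c where
    c: "c \<in> Conf" "e \<notin> c" "e' \<notin> c" "insert e c \<in> Conf" "insert e' c \<in> Conf" by blast
  obtain p where p: "dpath p" "F p = c" using conf_F[OF c(1)] by blast
  obtain s where s: "dpath (p @ [(s, True)])" "F (p @ [(s, True)]) = insert e c"
    using F_step[OF p(1), of e] p c by auto
  obtain t where t: "dpath (p @ [(t, True)])" "F (p @ [(t, True)]) = insert e' c"
    using F_step[OF p(1), of e'] p c by auto
  have L: "L s = lab e" "L t = lab e'" using lab_step s t p(2) c(2,3) by metis+
  have "e \<noteq> e'" using cf cf_irrefl e by blast
  then have "s \<noteq> t" using s(2) t(2) c by auto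
  then have "L s \<noteq> L t" using deterministic[of s t] s(1) t(1) by (auto simp: dpath_snoc)
  moreover have "\<not> I (L s) (L t)"
  proof
    assume "I (L s) (L t)"
    then obtain s' t' where sq: "square X s t s' t'"
      using fork[of s t] s(1) t(1) by (auto simp: dpath_snoc)
    have "path_from X u p" "path_end X u p = src X s" using s(1) by (auto simp: dpath_def step_src_def)
    note h = homotopic_square[OF sq this]
    let ?q = "p @ [(s, True), (t', True)]" and ?r = "p @ [(t, True), (s', True)]"
    have q: "dpath ?q" "dpath ?r" using h s(1) by (auto simp: dpath_def)
    have "F (p @ [(s, True)]) \<subseteq> F ?q"
      unfolding F_subset[OF s(1) q(1)] using q(1) by (intro exI[of _ "[(t', True)]"]) simp
    moreover have "F (p @ [(t, True)]) \<subseteq> F ?q"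
      unfolding F_subset[OF t(1) q(1)] using q(2) homotopic_sym[OF h(3)]
      by (intro exI[of _ "[(s', True)]"]) simp
    ultimately have "e \<in> F ?q" "e' \<in> F ?q" unfolding s(2) t(2) by blast+
    then show False using confD(3)[OF F_conf[OF q(1)]] cf by blast
  qed
  ultimately show ?thesis unfolding L by simp
qed

text \<open>With independent labels, the consecutive edges of \<open>e\<close> and \<open>e'\<close>
  would lie on a square, whose other side starts with an edge carrying the label of
  \<open>e'\<close>. That edge fires either \<open>e'\<close>, which is impossible before its cause
  \<open>e\<close>, or \<open>e\<close>, whose label would then be independent of itself.\<close>

lemma lessdot_labels:
  assumes "lessdot E le e e'"
  shows "\<not> I (lab e) (lab e')"
proof
  assume I: "I (lab e) (lab e')"
  have e: "e \<in> E" "e' \<in> E" "le e e'" "e \<noteq> e'"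
    and cov: "\<And>x. x \<in> E \<Longrightarrow> le e x \<Longrightarrow> le x e' \<Longrightarrow> x = e \<or> x = e'"
    using assms unfolding lessdot_def by blast+
  define d where "d = below e' - {e}"
  \<comment> \<open>As \<open>e'\<close> covers \<open>e\<close>, no event of
    \<open>below e'\<close> lies strictly above \<open>e\<close>.\<close>
  have d: "d \<in> Conf" unfolding d_def
    using below_conf[OF e(2)] by (rule conf_remove) (use cov in \<open>auto simp: below_def\<close>)
  have ins: "insert e d = below e'" using e by (auto simp: d_def below_def)
  have ed: "e \<notin> d" "e' \<notin> below e'" by (auto simp: d_def below_def)
  obtain p where p: "dpath p" "F p = d" using conf_F[OF d] by blast
  obtain s where s: "dpath (p @ [(s, True)])" "F (p @ [(s, True)]) = insert e d"
    using F_step[OF p(1), of e] ed below_conf[OF e(2)] ins p(2) by auto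
  obtain t where t: "dpath (p @ [(s, True), (t, True)])"
      "F (p @ [(s, True), (t, True)]) = insert e' (insert e d)"
    using F_step[OF s(1), of e'] ed insert_below_conf[OF e(2)] ins s(2) by auto
  have "L s = lab e" using lab_step[OF s(1)] s(2) p(2) ed by simp
  moreover have "L t = lab e'" using lab_step[of "p @ [(s, True)]" t e'] t s(2) ed ins by simp
  ultimately have It: "I (L s) (L t)" using I by simp
  have ed': "s \<in> edges X" "t \<in> edges X" "tgt X s = src X t" "path_end X u p = src X s"
    using t(1) by (auto simp: dpath_def step_src_def step_tgt_def)
  obtain b a where sq: "square X s b a t"
    using chain[OF ed'(1-3) It] by blast
  have "path_from X u p" using p by (simp add: dpath_def)
  note h = homotopic_square[OF sq this ed'(4)]
  have b: "dpath (p @ [(b, True)])" and ba: "dpath (p @ [(b, True), (a, True)])"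
    using h(2) t(1) by (auto simp: dpath_def)
  obtain x where x: "x \<notin> d" "F (p @ [(b, True)]) = insert x d"
    using F_extend[OF b] p(2) by metis
  have "F (p @ [(b, True)]) \<subseteq> F (p @ [(s, True), (t, True)])"
    unfolding F_subset[OF b t(1)] using ba homotopic_sym[OF h(3)]
    by (intro exI[of _ "[(a, True)]"]) simp
  then have "x = e \<or> x = e'" using x t(2) by auto
  then show False
  proof
    assume "x = e'"
    then show False
      using confD(4)[OF F_conf[OF b], of e' e] x e ed by auto
  next
    assume "x = e"
    then have "L b = L s" using step_label_unique[OF b s(1)] x s(2) by simp
    moreover have "L b = L t" using square_label[OF sq] by simp
    ultimately show False using It I_irrefl by simp
  qed
qed

text \<open>Unrelated events without conflict can both be added to a common past, and the diamond
  that they form gives independent labels.\<close>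

lemma dependent_labels:
  assumes e: "e \<in> E" "e' \<in> E" and nI: "\<not> I (lab e) (lab e')"
  shows "le e e' \<or> le e' e \<or> cf e e'"
proof (rule ccontr)
  assume "\<not> ?thesis"
  then have n: "\<not> le e e'" "\<not> le e' e" "\<not> cf e e'" by blast+
  then have m: "\<forall>x\<in>E. \<forall>y\<in>E. le x e \<and> le y e' \<and> cf x y \<longrightarrow> x = e \<and> y = e'"
    using cf_inherit2[of _ _ e e'] e by blast
  from common_past[OF e n(1,2) m] obtain c where
    c: "c \<in> Conf" "e \<notin> c" "e' \<notin> c" "insert e c \<in> Conf" "insert e' c \<in> Conf" by metis
  have "insert e' (insert e c) \<in> Conf"
    using c(4) e(2)
  proof (rule conf_insert)
    show "below e' \<subseteq> insert e c" using below_subset[OF c(5)] by blast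
    show "\<not> cf x e'" if "x \<in> insert e c" for x using that n(3) confD(3)[OF c(5)] by blast
  qed
  moreover have "e \<noteq> e'" using n(1) le_refl e by blast
  moreover obtain p where p: "dpath p" "F p = c" using conf_F[OF c(1)] by blast
  ultimately obtain s t s' where
    s: "dpath (p @ [(s, True)])" "F (p @ [(s, True)]) = insert e c" and
    t: "dpath (p @ [(t, True)])" "F (p @ [(t, True)]) = insert e' c" and
    "dpath (p @ [(t, True)] @ [(s', True)])"
    "F (p @ [(t, True)] @ [(s', True)]) = insert e (insert e' c)" "L s = L s'" and
    "I (L s) (L t)"
    using diamond[OF p(1), of e e', unfolded p(2)] c by blast
  moreover have "L s = lab e" "L t = lab e'" using lab_step s t p(2) c(2,3) by metis+
  ultimately show False using nI by simp
qed

lemma trace_labeling: "trace_labeling E le cf labels I lab"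
  unfolding trace_labeling_def dep_def
  using lab_in_labels min_conflict_labels lessdot_labels dependent_labels by blast

section \<open>Futures and regularity\<close>

lemma future_F:
  assumes "dpath p"
  shows "c \<in> future E le cf (F p) \<longleftrightarrow> (\<exists>r. dpath (p @ r) \<and> F (p @ r) = c)"
proof
  assume "c \<in> future E le cf (F p)"
  then have c: "c \<in> Conf" "F p \<subseteq> c" by (auto simp: future_def)
  obtain q where q: "dpath q" "F q = c" using conf_F[OF c(1)] by blast
  then obtain r where r: "dpath (p @ r)" "homotopic X u (p @ r) q"
    using F_subset[OF assms q(1)] c by blast
  then show "\<exists>r. dpath (p @ r) \<and> F (p @ r) = c" using F_eq[OF r(1) q(1)] q(2) by blast
next
  assume "\<exists>r. dpath (p @ r) \<and> F (p @ r) = c"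
  then obtain r where r: "dpath (p @ r)" "F (p @ r) = c" by blast
  then have "F p \<subseteq> F (p @ r)" unfolding F_subset[OF assms r(1)] by (intro exI[of _ r]) simp
  then show "c \<in> future E le cf (F p)" using r F_conf by (auto simp: future_def)
qed

context
  fixes p q
  assumes p: "dpath p" and q: "dpath q" and same_end: "path_end X u p = path_end X u q"
begin

lemma dpath_transfer: "dpath (p @ r) \<longleftrightarrow> dpath (q @ r)"
  using p q same_end by (simp add: dpath_def)

text \<open>Cancelling the prefix reduces both sides to homotopy of \<open>r\<close> and
  \<open>r'\<close> from the common endpoint.\<close>

lemma homotopic_transfer:
  assumes "dpath (p @ r)"
  shows "homotopic X u (p @ r) (p @ r') \<longleftrightarrow> homotopic X u (q @ r) (q @ r')"
proof -
  have iff: "homotopic X u (x @ r) (x @ r') \<longleftrightarrow> homotopic X (path_end X u x) r r'"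
    if x: "dpath (x @ r)" for x
  proof
    have x: "path_from X u (x @ r)" using x by (simp add: dpath_def)
    show "homotopic X (path_end X u x) r r'" if "homotopic X u (x @ r) (x @ r')"
      using x that by (rule homotopic_cancel_left)
    show "homotopic X u (x @ r) (x @ r')" if "homotopic X (path_end X u x) r r'"
      using x that by (intro homotopic_append_left) simp_all
  qed
  show ?thesis using iff[of p] iff[of q] assms dpath_transfer same_end by simp
qed

lemma F_subset_transfer:
  assumes r: "dpath (p @ r)" and r': "dpath (p @ r')"
  shows "F (p @ r) \<subseteq> F (p @ r') \<longleftrightarrow> F (q @ r) \<subseteq> F (q @ r')"
proof -
  have q: "dpath (q @ r)" "dpath (q @ r')" using r r' dpath_transfer by auto
  have "dpath ((p @ r) @ t) \<and> homotopic X u ((p @ r) @ t) (p @ r') \<longleftrightarrow>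
    dpath ((q @ r) @ t) \<and> homotopic X u ((q @ r) @ t) (q @ r')" for t
    using dpath_transfer[of "r @ t"] homotopic_transfer[of "r @ t" r'] by auto
  then show ?thesis unfolding F_subset[OF r r'] F_subset[OF q] by simp
qed

text \<open>The isomorphism exchanges the prefix \<open>p\<close> for \<open>q\<close>. The added
  event may change, but it is fired by the same edge, and the edge determines the label.\<close>

lemma future_iso_same_end: "future_iso E le cf lab (F p) (F q)"
proof -
  define phi where "phi c = F (q @ (SOME r. dpath (p @ r) \<and> F (p @ r) = c))" for c
  have phi: "phi (F (p @ r)) = F (q @ r)" if r: "dpath (p @ r)" for r
  proof -
    define r' where "r' = (SOME r'. dpath (p @ r') \<and> F (p @ r') = F (p @ r))"
    have "dpath (p @ r') \<and> F (p @ r') = F (p @ r)"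
      unfolding r'_def by (rule someI[of _ r]) (simp add: r)
    then have "F (q @ r') = F (q @ r)"
      using F_subset_transfer[OF r, of r'] F_subset_transfer[OF _ r, of r'] by auto
    then show ?thesis by (simp add: phi_def r'_def)
  qed
  show ?thesis unfolding future_iso_def
  proof (intro exI[of _ phi] conjI ballI allI impI)
    show mono: "c \<subseteq> d \<longleftrightarrow> phi c \<subseteq> phi d"
      if cd: "c \<in> future E le cf (F p)" "d \<in> future E le cf (F p)" for c d
    proof -
      obtain r r' where "dpath (p @ r)" "F (p @ r) = c" "dpath (p @ r')" "F (p @ r') = d"
        using cd unfolding future_F[OF p] by blast
      then show ?thesis using F_subset_transfer phi by metis
    qed
    show "bij_betw phi (future E le cf (F p)) (future E le cf (F q))"
      unfolding bij_betw_def
    proof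
      show "inj_on phi (future E le cf (F p))"
      proof (rule inj_onI)
        fix c d assume "c \<in> future E le cf (F p)" "d \<in> future E le cf (F p)" "phi c = phi d"
        then show "c = d" using mono[of c d] mono[of d c] by auto
      qed
      show "phi ` future E le cf (F p) = future E le cf (F q)"
      proof (intro set_eqI iffI)
        fix d assume "d \<in> phi ` future E le cf (F p)"
        then obtain r where r: "dpath (p @ r)" "d = phi (F (p @ r))"
          using future_F[OF p] by auto
        then show "d \<in> future E le cf (F q)"
          unfolding future_F[OF q] r(2) phi[OF r(1)] using dpath_transfer by auto
      next
        fix d assume "d \<in> future E le cf (F q)"
        then obtain r where "dpath (q @ r)" "d = F (q @ r)" unfolding future_F[OF q] by blast
        then have r: "dpath (p @ r)" "d = phi (F (p @ r))" using phi dpath_transfer by auto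
        then have "F (p @ r) \<in> future E le cf (F p)" using future_F[OF p] by auto
        then show "d \<in> phi ` future E le cf (F p)" using r(2) by simp
      qed
    qed
    fix c e assume c: "c \<in> future E le cf (F p)" and e: "e \<notin> c \<and> insert e c \<in> future E le cf (F p)"
    obtain r where r: "dpath (p @ r)" "F (p @ r) = c" using c unfolding future_F[OF p] by blast
    have "insert e c \<in> Conf" using e by (simp add: future_def)
    then obtain s where s: "dpath ((p @ r) @ [(s, True)])" "F ((p @ r) @ [(s, True)]) = insert e c"
      using F_step[OF r(1), of e] r(2) e by auto
    have qs: "dpath ((q @ r) @ [(s, True)])" using s(1) dpath_transfer[of "r @ [(s, True)]"] by simp
    obtain e' where e': "e' \<notin> F (q @ r)" "F ((q @ r) @ [(s, True)]) = insert e' (F (q @ r))"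
      using F_extend[OF qs] by blast
    have "lab e' = lab e"
      using lab_step[OF s(1), of e] lab_step[OF qs e'(2,1)] s(2) r(2) e by simp
    moreover have "phi c = F (q @ r)" "phi (insert e c) = F ((q @ r) @ [(s, True)])"
      using phi[OF r(1)] phi[of "r @ [(s, True)]"] r(2) s by auto
    ultimately show "\<exists>e'. e' \<notin> phi c \<and> phi (insert e c) = insert e' (phi c) \<and> lab e' = lab e"
      using e' by auto
  qed
qed

end

lemma regular_labeling:
  assumes "finite (verts X)"
  shows "regular_labeling E le cf lab"
proof -
  define pick where "pick v = (SOME p. dpath p \<and> path_end X u p = v)" for v
  define R where "R = (\<lambda>v. F (pick v)) ` (path_end X u ` Collect dpath)"
  have pick: "dpath (pick (path_end X u p)) \<and> path_end X u (pick (path_end X u p)) = path_end X u p"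
    if "dpath p" for p
    unfolding pick_def by (rule someI[of _ p]) (simp add: that)
  have "path_end X u ` Collect dpath \<subseteq> verts X"
    using path_end_in_verts[OF dcomplex u] by (auto simp: dpath_def)
  then have "finite R" unfolding R_def using assms finite_subset by blast
  moreover have "R \<subseteq> Conf" unfolding R_def using pick F_conf by blast
  moreover have "\<exists>d\<in>R. future_iso E le cf lab c d" if c: "c \<in> Conf" for c
  proof -
    obtain p where p: "dpath p" "F p = c" using conf_F[OF c] by blast
    have "future_iso E le cf lab (F p) (F (pick (path_end X u p)))"
      using pick[OF p(1)] by (intro future_iso_same_end p(1)) auto
    moreover have "F (pick (path_end X u p)) \<in> R" unfolding R_def using p(1) by blast
    ultimately show ?thesis using p(2) by blast
  qed
  ultimately show ?thesis unfolding regular_labeling_def by blast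
qed

lemma regular_trace:
  assumes "finite_dcomplex X"
  shows "regular_trace_event_structure E le cf"
proof -
  have "trace_alphabet labels I"
    unfolding trace_alphabet_def labels_def
    using assms I_labels I_labels[OF I_sym] I_sym I_irrefl by (auto simp: finite_dcomplex_def)
  then show ?thesis
    unfolding regular_trace_event_structure_def
    using trace_labeling regular_labeling assms by (auto simp: finite_dcomplex_def)
qed

end

subsection \<open>Hyperplane labels of special complexes\<close>

definition hyp :: "('v, 'e, 'z) dcomplex_scheme \<Rightarrow> 'e \<Rightarrow> 'e set" where
  "hyp X e = {e' \<in> edges X. (\<lambda>a b. sq_opposite X a b \<or> sq_opposite X b a)\<^sup>*\<^sup>* e e'}"

text \<open>Labels have to be natural numbers. Edges are natural numbers here and hyperplanes
  partition them, so the least edge encodes its hyperplane faithfully.\<close>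

definition hyp_label :: "('v, nat, 'z) dcomplex_scheme \<Rightarrow> nat \<Rightarrow> nat" where
  "hyp_label X e = (LEAST e'. e' \<in> hyp X e)"

definition crossing_labels :: "('v, nat, 'z) dcomplex_scheme \<Rightarrow> nat \<Rightarrow> nat \<Rightarrow> bool" where
  "crossing_labels X k l \<longleftrightarrow>
    (\<exists>a b a' b'. square X a b a' b' \<and> k = hyp_label X a \<and> l = hyp_label X b)"

lemma hyp_self: "e \<in> edges X \<Longrightarrow> e \<in> hyp X e"
  by (simp add: hyp_def)

lemma hyp_hyperplane: "e \<in> edges X \<Longrightarrow> hyp X e \<in> hyperplanes X"
  unfolding hyp_def hyperplanes_def by blast

lemma hyp_eq:
  assumes "e' \<in> hyp X e"
  shows "hyp X e' = hyp X e"
proof -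
  let ?R = "(\<lambda>a b. sq_opposite X a b \<or> sq_opposite X b a)\<^sup>*\<^sup>*"
  have "?R e e'" using assms by (simp add: hyp_def)
  moreover have "symp ?R" by (rule symp_rtranclp) (auto intro: sympI)
  ultimately have "?R e' e" by (auto dest: sympD)
  then have "?R e' x \<longleftrightarrow> ?R e x" for x
    using \<open>?R e e'\<close> rtranclp_trans[of _ e e' x] rtranclp_trans[of _ e' e x] by auto
  then show ?thesis by (simp add: hyp_def)
qed

lemma hyp_label_eq_iff:
  assumes "a \<in> edges X" "b \<in> edges X"
  shows "hyp_label X a = hyp_label X b \<longleftrightarrow> hyp X a = hyp X b"
proof
  assume "hyp_label X a = hyp_label X b"
  moreover have "hyp_label X e \<in> hyp X e" if "e \<in> edges X" for e
    unfolding hyp_label_def by (rule LeastI) (rule hyp_self[OF that])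
  ultimately show "hyp X a = hyp X b" using hyp_eq assms by metis
qed (simp add: hyp_label_def)

text \<open>\<open>sq_opposite\<close> compares only the sides in coordinate direction 0; the other
  pair of sides is reached through \<open>square_sym\<close>.\<close>

lemma square_hyp_label:
  assumes X: "dcomplex X" and sq: "square X a b a' b'"
  shows "hyp_label X a = hyp_label X a'"
proof -
  have "sq_opposite X a a'" using sq unfolding square_def sq_opposite_def by blast
  then have "a' \<in> hyp X a" using square_edges(3)[OF X sq] by (auto simp: hyp_def)
  from hyp_eq[OF this] show ?thesis by (simp add: hyp_label_def)
qed

lemma square_corner_two:
  assumes "square_corner X v x y"
  obtains c S where "c \<in> cubes X" "cdim c = 2" "S = {} \<or> S = {0} \<or> S = {1} \<or> S = {0, 1}"
    "{corner_end c S 0, corner_end c S 1} = {x, y}"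
proof -
  obtain c S where c: "c \<in> cubes X" "cdim c = 2" "S \<subseteq> {..<2}" "corner_set c S = {x, y}"
    using assms unfolding square_corner_def by blast
  moreover have "{..<2} = {0, 1::nat}" by auto
  ultimately show ?thesis using that subset_two by (simp add: corner_set_def)
qed

text \<open>Only the initial corner of a square has both ends leaving; every other corner has an
  entering edge.\<close>

lemma square_corner_out:
  assumes X: "dcomplex X" and c: "square_corner X v (a, True) (b, True)"
  shows "\<exists>a' b'. square X a b a' b'"
proof -
  obtain c S where c: "c \<in> cubes X" "cdim c = 2" "S = {} \<or> S = {0} \<or> S = {1} \<or> S = {0, 1}"
    "{corner_end c S 0, corner_end c S 1} = {(a, True), (b, True)}"
    using c by (rule square_corner_two)
  have sq: "square X (ce c {} 0) (ce c {} 1) (ce c {1} 0) (ce c {0} 1)"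
    using c(1,2) unfolding square_def by blast
  have "{(ce c {} 0, True), (ce c {} 1, True)} = {(a, True), (b, True)}"
    using c(3,4) by (auto simp: corner_end_def doubleton_eq_iff)
  then have "a = ce c {} 0 \<and> b = ce c {} 1 \<or> a = ce c {} 1 \<and> b = ce c {} 0"
    by (auto simp: doubleton_eq_iff)
  then show ?thesis using sq square_sym[OF X sq] by blast
qed

text \<open>One entering and one leaving end occur at the corners \<open>{0}\<close> and
  \<open>{1}\<close>, which the coordinate swap exchanges.\<close>

lemma square_corner_in_out:
  assumes X: "dcomplex X" and c: "square_corner X v (a, False) (b', True)"
  shows "\<exists>b a'. square X a b a' b'"
proof -
  obtain c S where c: "c \<in> cubes X" "cdim c = 2" "S = {} \<or> S = {0} \<or> S = {1} \<or> S = {0, 1}"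
    "{corner_end c S 0, corner_end c S 1} = {(a, False), (b', True)}"
    using c by (rule square_corner_two)
  have sq: "square X (ce c {} 0) (ce c {} 1) (ce c {1} 0) (ce c {0} 1)"
    using c(1,2) unfolding square_def by blast
  have "a = ce c {} 0 \<and> b' = ce c {0} 1 \<or> a = ce c {} 1 \<and> b' = ce c {1} 0"
    using c(3,4) by (auto simp: corner_end_def doubleton_eq_iff)
  then show ?thesis using sq square_sym[OF X sq] by blast
qed

text \<open>Irreflexivity is the absence of self-intersection. Determinism takes two conditions: two
  edges of one hyperplane leaving a vertex would cross if they spanned a square there, and directly
  osculate otherwise.\<close>

lemma special_labelled_complex:
  assumes X: "dcomplex X" and sp: "special X"
  shows "labelled_complex X (hyp_label X) (crossing_labels X)"
proof
  let ?L = "hyp_label X"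
  show irrefl: "\<not> crossing_labels X k k" for k
  proof
    assume "crossing_labels X k k"
    then obtain a b a' b' where sq: "square X a b a' b'" and L: "?L a = ?L b"
      unfolding crossing_labels_def by auto
    have e: "a \<in> edges X" "b \<in> edges X" using square_edges[OF X sq] by auto
    then have "hyp X a = hyp X b" using L hyp_label_eq_iff[OF e] by simp
    then have "a \<in> hyp X a" "b \<in> hyp X a"
      using hyp_self[OF e(1)] hyp_self[OF e(2)] by simp_all
    then have "self_intersects X (hyp X a)"
      using sq unfolding square_def self_intersects_def by blast
    then show False using sp hyp_hyperplane[OF e(1)] unfolding special_def by blast
  qed
  show square_label: "?L a = ?L a' \<and> ?L b = ?L b' \<and> crossing_labels X (?L a) (?L b)"
    if "square X a b a' b'" for a b a' b'
    using square_hyp_label[OF X that] square_hyp_label[OF X square_sym[OF X that]] that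
    unfolding crossing_labels_def by blast
  show "crossing_labels X l k" if "crossing_labels X k l" for k l
    using that square_sym[OF X] unfolding crossing_labels_def by blast
  show "k \<in> ?L ` edges X" if "crossing_labels X k l" for k l
    using that square_edges(1)[OF X] unfolding crossing_labels_def by blast
  show "a = b" if ab: "a \<in> edges X" "b \<in> edges X" "src X a = src X b" "?L a = ?L b" for a b
  proof (rule ccontr)
    assume ne: "a \<noteq> b"
    let ?v = "src X a"
    have "hyp X a = hyp X b" using ab(4) hyp_label_eq_iff[OF ab(1,2)] by simp
    then have h: "a \<in> hyp X a" "b \<in> hyp X a"
      using hyp_self[OF ab(1)] hyp_self[OF ab(2)] by simp_all
    have "\<not> directly_self_osculates X (hyp X a)"
      using sp hyp_hyperplane[OF ab(1)] by (simp add: special_def)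
    moreover have "?v \<in> verts X" using X ab(1) by (rule edge_verts)
    moreover have "(a, True) \<in> edge_ends X ?v" "(b, True) \<in> edge_ends X ?v"
      using ab by (auto simp: edge_ends_def)
    ultimately have "square_corner X ?v (a, True) (b, True)"
      using ne h unfolding directly_self_osculates_def by blast
    then obtain a' b' where "square X a b a' b'" using square_corner_out[OF X] by blast
    then show False using square_label irrefl ab(4) by metis
  qed
  \<comment> \<open>The directions \<open>s\<close> and \<open>t\<close> are arbitrary, so this one
    consequence of the absence of inter-osculation yields both forks (two leaving ends) and chains
    (one entering, one leaving).\<close>
  have corner: "square_corner X v (a, s) (b, t)"
    if ab: "(a, s) \<in> edge_ends X v" "(b, t) \<in> edge_ends X v" "v \<in> verts X"
      and cr: "crossing_labels X (?L a) (?L b)" for a b s t v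
  proof -
    have e: "a \<in> edges X" "b \<in> edges X" using ab by (auto simp: edge_ends_def)
    obtain c d c' d' where sq: "square X c d c' d'" and L: "?L a = ?L c" "?L b = ?L d"
      using cr unfolding crossing_labels_def by blast
    note cd = square_edges(1,2)[OF X sq]
    have "hyp X a = hyp X c" "hyp X b = hyp X d"
      using L hyp_label_eq_iff[OF e(1) cd(1)] hyp_label_eq_iff[OF e(2) cd(2)] by simp_all
    then have "c \<in> hyp X a" "d \<in> hyp X b" using hyp_self[OF cd(1)] hyp_self[OF cd(2)] by simp_all
    then have "\<exists>c\<in>cubes X. cdim c = 2 \<and> ce c {} 0 \<in> hyp X a \<and> ce c {} 1 \<in> hyp X b"
      using sq unfolding square_def by blast
    moreover have "hyp X a \<noteq> hyp X b" using cr irrefl hyp_label_eq_iff[OF e] by metis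
    moreover have "\<not> inter_osculate X (hyp X a) (hyp X b)"
      using sp hyp_hyperplane[OF e(1)] hyp_hyperplane[OF e(2)] unfolding special_def by blast
    ultimately show ?thesis
      using ab hyp_self[OF e(1)] hyp_self[OF e(2)] unfolding inter_osculate_def by blast
  qed
  show "\<exists>a' b'. square X a b a' b'"
    if ab: "a \<in> edges X" "b \<in> edges X" "src X a = src X b" "crossing_labels X (?L a) (?L b)" for a b
  proof -
    have "src X a \<in> verts X" using X ab(1) by (rule edge_verts)
    then have "square_corner X (src X a) (a, True) (b, True)"
      using ab by (intro corner) (auto simp: edge_ends_def)
    then show ?thesis by (rule square_corner_out[OF X])
  qed
  show "\<exists>b a'. square X a b a' b'"
    if ab: "a \<in> edges X" "b' \<in> edges X" "tgt X a = src X b'" "crossing_labels X (?L a) (?L b')"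
    for a b'
  proof -
    have "src X b' \<in> verts X" using X ab(2) by (rule edge_verts)
    then have "square_corner X (src X b') (a, False) (b', True)"
      using ab by (intro corner) (auto simp: edge_ends_def)
    then show ?thesis by (rule square_corner_in_out[OF X])
  qed
qed (rule X)

subsection \<open>Lifting paths and homotopies to a covering\<close>

definition map_path :: "('e \<Rightarrow> 'f) \<Rightarrow> ('e \<times> bool) list \<Rightarrow> ('f \<times> bool) list" where
  "map_path g = map (\<lambda>(e, b). (g e, b))"

lemma map_path_simps [simp]:
  "map_path g [] = []"
  "map_path g ((e, b) # p) = (g e, b) # map_path g p"
  "map_path g (p @ q) = map_path g p @ map_path g q"
  by (simp_all add: map_path_def)

lemma directed_map_path [simp]: "directed_path (map_path g p) \<longleftrightarrow> directed_path p"
  by (auto simp: directed_path_def map_path_def)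

lemma edge_ends_iff: "(e, b) \<in> edge_ends X v \<longleftrightarrow> e \<in> edges X \<and> step_src X (e, b) = v"
  by (auto simp: edge_ends_def step_src_def)

section \<open>Squares with a given corner in an NPC complex\<close>

lemma npc_inj:
  assumes "npc X" "c \<in> cubes X" "S \<subseteq> {..<cdim c}"
  shows "inj_on (corner_end c S) {..<cdim c}"
  using conjunct1[OF assms(1)[unfolded npc_def]] assms(2,3) by simp

lemma npc_simplex_unique:
  assumes "npc X" "c \<in> cubes X" "d \<in> cubes X" "S \<subseteq> {..<cdim c}" "T \<subseteq> {..<cdim d}"
    "cv c S = cv d T" "corner_set c S = corner_set d T"
  obtains p where "bij_betw p {..<cdim d} {..<cdim c}" "p ` T = S"
    "same_cube d (subcube c {} (cdim d) p)"
  using conjunct1[OF conjunct2[OF assms(1)[unfolded npc_def]],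
      rule_format, of c d S T] assms(2-7) by auto

text \<open>Links have no loops, whence \<open>a \<noteq> b\<close>, and no two simplices on the
  same vertices, so the two squares agree up to a permutation of coordinates. This permutation fixes
  two distinct edges and hence is the identity.\<close>

lemma square_unique:
  assumes X: "dcomplex X" "npc X" and sq: "square X a b a' b'" "square X a b a'' b''"
  shows "a \<noteq> b \<and> a' = a'' \<and> b' = b''"
proof -
  obtain c where c: "c \<in> cubes X" "cdim c = 2"
    "a = ce c {} 0" "b = ce c {} 1" "a' = ce c {1} 0" "b' = ce c {0} 1"
    using sq(1) unfolding square_def by blast
  obtain d where d: "d \<in> cubes X" "cdim d = 2"
    "a = ce d {} 0" "b = ce d {} 1" "a'' = ce d {1} 0" "b'' = ce d {0} 1"
    using sq(2) unfolding square_def by blast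
  have wf: "well_formed_cube X c" "well_formed_cube X d" using X(1) c(1) d(1) by (auto simp: dcomplex_def)
  have two: "{..<2} = {0, 1::nat}" by auto
  have "inj_on (corner_end c {}) {..<cdim c}" using npc_inj[OF X(2) c(1)] by simp
  then have ab: "a \<noteq> b" unfolding c(2-4) two by (auto simp: corner_end_def)
  have "cv c {} = cv d {}"
    using well_formed_square(2)[OF wf(1) c(2)] well_formed_square(2)[OF wf(2) d(2)] c(3) d(3) by simp
  moreover have "corner_set c {} = corner_set d {}"
    unfolding corner_set_def c(2) d(2) two using c d by (simp add: corner_end_def)
  ultimately obtain p where p: "bij_betw p {..<cdim d} {..<cdim c}"
      "same_cube d (subcube c {} (cdim d) p)"
    using npc_simplex_unique[OF X(2) c(1) d(1), of "{}" "{}"] by blast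
  let ?s = "subcube c {} 2 p"
  have s: "same_cube d ?s" "cdim ?s = 2" using p(2) d(2) by (simp_all add: subcube_def cdim_def)
  note e = same_square_edges[OF s]
  have ce_s: "ce ?s T i = ce c (p ` T) (p i)" for T i by (simp add: subcube_def ce_def)
  have "p 0 \<in> {0, 1}" "p 1 \<in> {0, 1}"
    using p(1) unfolding c(2) d(2) two bij_betw_def by blast+
  then have "p 0 = 0" "p 1 = 1" using e(2,3) c(3,4) d(3,4) ab unfolding ce_s by auto
  then show ?thesis using ab e(4,5) c d unfolding ce_s by simp
qed

locale covering =
  fixes Y :: "('v, 'e, 'z) dcomplex_scheme" and X :: "('w, 'f, 'y) dcomplex_scheme"
    and fv :: "'v \<Rightarrow> 'w" and fe :: "'e \<Rightarrow> 'f"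
  assumes Y: "dcomplex Y" "npc Y" and X: "dcomplex X" "npc X"
    and cover: "covering_map Y X fv fe"
begin

section \<open>Lifting paths\<close>

lemma cover_edge:
  assumes "e \<in> edges Y"
  shows "fe e \<in> edges X" "src X (fe e) = fv (src Y e)" "tgt X (fe e) = fv (tgt Y e)"
  using cover assms unfolding covering_map_def by blast+

lemma cover_ends:
  "y \<in> verts Y \<Longrightarrow> bij_betw (\<lambda>(e, b). (fe e, b)) (edge_ends Y y) (edge_ends X (fv y))"
  using cover unfolding covering_map_def by blast

lemma step_end_in_verts: "e \<in> edges Y \<Longrightarrow> step_tgt Y (e, b) \<in> verts Y"
  using edge_verts[OF Y(1)] by (simp add: step_tgt_def)

lemma map_path_from:
  "path_from Y y p \<Longrightarrow> path_from X (fv y) (map_path fe p) \<and>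
     path_end X (fv y) (map_path fe p) = fv (path_end Y y p)"
proof (induction p arbitrary: y)
  case (Cons s p)
  obtain e b where s: "s = (e, b)" by force
  have "step_tgt X (fe e, b) = fv (step_tgt Y (e, b))" "step_src X (fe e, b) = fv (step_src Y (e, b))"
    using Cons.prems cover_edge[of e] by (auto simp: s step_src_def step_tgt_def)
  then show ?case using Cons cover_edge[of e] by (auto simp: s)
qed simp

lemma lift_path:
  "y \<in> verts Y \<Longrightarrow> path_from X (fv y) q \<Longrightarrow> \<exists>p. path_from Y y p \<and> map_path fe p = q"
proof (induction q arbitrary: y)
  case (Cons s q)
  obtain e b where s: "s = (e, b)" by force
  have "s \<in> edge_ends X (fv y)" using Cons.prems by (simp add: s edge_ends_iff)
  then have "s \<in> (\<lambda>(e, b). (fe e, b)) ` edge_ends Y y"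
    using cover_ends[OF Cons.prems(1)] unfolding bij_betw_def by simp
  then obtain d where d: "(d, b) \<in> edge_ends Y y" "fe d = e" by (auto simp: s)
  then have d': "d \<in> edges Y" "step_src Y (d, b) = y" by (simp_all add: edge_ends_iff)
  have "step_tgt X s = fv (step_tgt Y (d, b))"
    using cover_edge[OF d'(1)] d(2) by (simp add: s step_tgt_def)
  then obtain p where "path_from Y (step_tgt Y (d, b)) p" "map_path fe p = q"
    using Cons.IH[of "step_tgt Y (d, b)"] Cons.prems(2) step_end_in_verts[OF d'(1)] by auto
  then show ?case using d d' s by (intro exI[of _ "(d, b) # p"]) simp
qed (auto intro: exI[of _ "[]"])

text \<open>Uniqueness of path lifting: a covering is injective on the edge ends at each
  vertex.\<close>

lemma map_path_inj:
  "y \<in> verts Y \<Longrightarrow> path_from Y y p \<Longrightarrow> path_from Y y q \<Longrightarrow> map_path fe p = map_path fe q \<Longrightarrow> p = q"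
proof (induction p arbitrary: y q)
  case Nil
  then show ?case by (simp add: map_path_def)
next
  case (Cons s p)
  obtain t q' where q: "q = t # q'" using Cons.prems(4) by (cases q) (auto simp: map_path_def)
  obtain e b where s: "s = (e, b)" by force
  obtain d b' where t: "t = (d, b')" by force
  have eq: "fe e = fe d" "b = b'" "map_path fe p = map_path fe q'"
    using Cons.prems(4) by (auto simp: q s t)
  have "(e, b) \<in> edge_ends Y y" "(d, b) \<in> edge_ends Y y"
    using Cons.prems(2,3) eq(2) by (auto simp: q s t edge_ends_iff)
  with cover_ends[OF Cons.prems(1)] eq(1) have "e = d"
    unfolding bij_betw_def inj_on_def by fastforce
  then show ?case
    using Cons.IH[of "step_tgt Y (e, b)" q'] Cons.prems eq step_end_in_verts[of e b]
    by (simp add: q s t)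
qed

section \<open>Lifting squares and homotopies\<close>

lemma map_square:
  assumes "square Y a b a' b'"
  shows "square X (fe a) (fe b) (fe a') (fe b')"
proof -
  obtain c where c: "c \<in> cubes Y" "cdim c = 2"
    "a = ce c {} 0" "b = ce c {} 1" "a' = ce c {1} 0" "b' = ce c {0} 1"
    using assms unfolding square_def by blast
  let ?d = "(cdim c, \<lambda>S. fv (cv c S), \<lambda>S i. fe (ce c S i))"
  have "has_cube X ?d" using cover c(1) unfolding covering_map_def by blast
  from square_has_cube[OF this] c show ?thesis by (simp add: ce_def cdim_def)
qed

text \<open>The covering only supplies some cube with a corner at \<open>y\<close> over the initial
  corner of the square. The corner is the initial one, since all its ends leave; the dimension is 2,
  since edge ends map injectively; the order of the coordinates is adjusted by
  \<open>square_sym\<close>; the far edges are right because \<open>X\<close> has only one square on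
  \<open>a\<close> and \<open>b\<close>.\<close>

lemma lift_square:
  assumes y: "y \<in> verts Y" and sq: "square X a b a' b'" and src: "src X a = fv y"
  obtains c d c' d' where "square Y c d c' d'" "src Y c = y"
    "fe c = a" "fe d = b" "fe c' = a'" "fe d' = b'"
proof -
  obtain k where k: "k \<in> cubes X" "cdim k = 2"
    "a = ce k {} 0" "b = ce k {} 1" "a' = ce k {1} 0" "b' = ce k {0} 1"
    using sq unfolding square_def by blast
  have wf: "well_formed_cube X k" using X(1) k(1) by (auto simp: dcomplex_def)
  let ?m = "\<lambda>(e, b). (fe e, b)"
  have two: "{..<2} = {0, 1::nat}" by auto
  have ends: "corner_set k {} = {(a, True), (b, True)}"
    unfolding corner_set_def k(2) two using k by (simp add: corner_end_def)
  have "cv k {} = fv y" using well_formed_square(2)[OF wf k(2)] k(3) src by simp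
  then obtain l T where l: "l \<in> cubes Y" "T \<subseteq> {..<cdim l}" "cv l T = y"
      "?m ` corner_set l T = corner_set k {}"
    using cover k(1) y unfolding covering_map_def by (metis empty_subsetI)
  have "i \<notin> T" for i
  proof
    assume i: "i \<in> T"
    then have "?m (corner_end l T i) \<in> corner_set k {}"
      using l(2,4) unfolding corner_set_def by blast
    then show False using i unfolding ends by (simp add: corner_end_def)
  qed
  then have T: "T = {}" by blast
  have wfl: "well_formed_cube Y l" using Y(1) l(1) by (auto simp: dcomplex_def)
  have sub: "corner_set l {} \<subseteq> edge_ends Y y"
    using wfl l(3) unfolding corner_set_def well_formed_cube_def T
    by (auto simp: corner_end_def edge_ends_def)
  have "inj_on (corner_end l {}) {..<cdim l}" using npc_inj[OF Y(2) l(1)] by simp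
  then have "card (corner_set l {}) = cdim l" unfolding corner_set_def by (simp add: card_image)
  moreover have "inj_on ?m (corner_set l {})"
    using cover_ends[OF y] sub unfolding bij_betw_def by (blast intro: inj_on_subset)
  then have "card (corner_set k {}) = card (corner_set l {})"
    using l(4) unfolding T by (metis card_image)
  moreover have "a \<noteq> b" using square_unique[OF X sq sq] by blast
  ultimately have dim: "cdim l = 2" unfolding ends by simp
  have sql: "square Y (ce l {} 0) (ce l {} 1) (ce l {1} 0) (ce l {0} 1)"
    using l(1) dim unfolding square_def by blast
  have srcl: "src Y (ce l {} 0) = y" "src Y (ce l {} 1) = y"
    using well_formed_square[OF wfl dim] l(3) T by simp_all
  have "corner_set l {} = {(ce l {} 0, True), (ce l {} 1, True)}"
    unfolding corner_set_def dim two by (simp add: corner_end_def)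
  then have "{(fe (ce l {} 0), True), (fe (ce l {} 1), True)} = {(a, True), (b, True)}"
    using l(4) unfolding T ends by simp
  then have "fe (ce l {} 0) = a \<and> fe (ce l {} 1) = b \<or> fe (ce l {} 0) = b \<and> fe (ce l {} 1) = a"
    by (auto simp: doubleton_eq_iff)
  then obtain c d c' d' where c: "square Y c d c' d'" "src Y c = y" "fe c = a" "fe d = b"
    using sql square_sym[OF Y(1) sql] srcl by blast
  have "square X a b (fe c') (fe d')" using map_square[OF c(1)] c(3,4) by simp
  then have "fe c' = a'" "fe d' = b'" using square_unique[OF X sq] by blast+
  then show ?thesis using that c by blast
qed

lemma lift_base_move:
  assumes y: "y \<in> verts Y" and m: "base_move X m m'" and p: "path_from X (fv y) m"
  shows "\<exists>n n'. path_from Y y n \<and> path_from Y y n' \<and> map_path fe n = m \<and> map_path fe n' = m' \<and>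
    base_move Y n n'"
proof -
  consider (cancel) e b where "m = [(e, b), (e, \<not> b)]" "m' = []"
    | (square) a b a' b' where "square X a b a' b'"
      "m = [(a, True), (b', True)]" "m' = [(b, True), (a', True)]"
    using m unfolding base_move_iff by blast
  then show ?thesis
  proof cases
    case (cancel e b)
    note m = this
    \<comment> \<open>Only the first step needs lifting; the reversal of its lift covers the
      second.\<close>
    have "path_from X (fv y) [(e, b)]" using p m by simp
    from lift_path[OF y this] obtain d where d: "path_from Y y [(d, b)]" "fe d = e"
      by (auto simp: map_path_def)
    then have "path_from Y y [(d, b), (d, \<not> b)]" by (auto simp: step_src_def step_tgt_def)
    moreover have "base_move Y [(d, b), (d, \<not> b)] []" unfolding base_move_iff by blast
    ultimately show ?thesis using d m
      by (intro exI[of _ "[(d, b), (d, \<not> b)]"] exI[of _ "[]"]) (simp add: base_move_iff)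
  next
    case (square a b a' b')
    note sq = square(1) and m = square(2,3)
    have "src X a = fv y" using p m by (simp add: step_src_def)
    with y sq obtain c d c' d' where c: "square Y c d c' d'" "src Y c = y"
      "fe c = a" "fe d = b" "fe c' = a'" "fe d' = b'" by (rule lift_square)
    then show ?thesis using square_edges[OF Y(1) c(1)] m
      by (intro exI[of _ "[(c, True), (d', True)]"] exI[of _ "[(d, True), (c', True)]"])
        (auto simp: step_src_def step_tgt_def base_move_iff)
  qed
qed

lemma lift_path_move:
  assumes y: "y \<in> verts Y" and m: "path_move X (fv y) P Q"
  shows "\<exists>p q. path_move Y y p q \<and> map_path fe p = P \<and> map_path fe q = Q"
proof -
  obtain x m m' z where pq: "P = x @ m @ z" "Q = x @ m' @ z" "base_move X m m'"
    "path_from X (fv y) P" "path_from X (fv y) Q"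
    using m by (rule path_moveE)
  obtain p where p: "path_from Y y p" "map_path fe p = x"
    using lift_path[OF y, of x] pq(1,4) by auto
  let ?w = "path_end Y y p"
  have w: "?w \<in> verts Y" "path_end X (fv y) x = fv ?w"
    using path_end_in_verts[OF Y(1) y p(1)] map_path_from[OF p(1)] p(2) by auto
  then obtain n n' where n: "path_from Y ?w n" "path_from Y ?w n'" "map_path fe n = m"
      "map_path fe n' = m'" "base_move Y n n'"
    using lift_base_move[OF w(1) pq(3)] pq(1,4) by auto
  let ?t = "path_end Y ?w n"
  have "path_move Y ?w n n'" using path_moveI[OF n(5), where u = ?w and x = "[]" and y = "[]"] n by simp
  \<comment> \<open>Both sides of the lifted move end at the same vertex, so a single lift of
    \<open>z\<close> continues both.\<close>
  then have t': "path_end Y ?w n' = ?t" using path_move_end[OF Y(1)] by metis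
  have t: "?t \<in> verts Y" "path_end X (fv ?w) m = fv ?t"
    using path_end_in_verts[OF Y(1) w(1) n(1)] map_path_from[OF n(1)] n(3) by auto
  then obtain q where q: "path_from Y ?t q" "map_path fe q = z"
    using lift_path[OF t(1), of z] pq(1,4) w(2) by auto
  have "path_move Y y (p @ n @ q) (p @ n' @ q)"
    using n(5) by (rule path_moveI) (use p n q t' in simp_all)
  then show ?thesis using p n q pq by (intro exI conjI) auto
qed

text \<open>Combinatorial form of the fact that \<open>Y\<close> and \<open>X\<close> share their
  universal cover. Moves lift one at a time, and uniqueness of path lifting makes successive lifts
  fit together and end in \<open>q\<close> itself.\<close>

lemma homotopic_map_path_iff:
  assumes y: "y \<in> verts Y" and p: "path_from Y y p" and q: "path_from Y y q"
  shows "homotopic X (fv y) (map_path fe p) (map_path fe q) \<longleftrightarrow> homotopic Y y p q"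
proof
  assume "homotopic X (fv y) (map_path fe p) (map_path fe q)"
  then have "(\<lambda>p q. path_move X (fv y) p q \<or> path_move X (fv y) q p)\<^sup>*\<^sup>*
      (map_path fe p) (map_path fe q)"
    unfolding homotopic_def .
  then have "\<exists>q'. path_from Y y q' \<and> map_path fe q' = map_path fe q \<and> homotopic Y y p q'"
  proof (induction rule: rtranclp_induct)
    case base
    then show ?case using p by auto
  next
    case (step P Q)
    then obtain p' where p': "path_from Y y p'" "map_path fe p' = P" "homotopic Y y p p'" by blast
    have "\<exists>r q'. (path_move Y y r q' \<or> path_move Y y q' r) \<and> map_path fe r = P \<and> map_path fe q' = Q"
      using step.hyps(2) lift_path_move[OF y, of P Q] lift_path_move[OF y, of Q P] by auto
    then obtain r q' where r: "path_move Y y r q' \<or> path_move Y y q' r"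
      "map_path fe r = P" "map_path fe q' = Q" by blast
    have "path_from Y y r" "path_from Y y q'" using r(1) by (auto elim: path_moveE)
    moreover have "r = p'"
      using map_path_inj[OF y \<open>path_from Y y r\<close> p'(1)] r(2) p'(2) by simp
    moreover have "homotopic Y y r q'" using r(1) by (auto intro: homotopic_move homotopic_sym)
    ultimately show ?case using homotopic_trans[OF p'(3)] r(3) by auto
  qed
  then obtain q' where "path_from Y y q'" "map_path fe q' = map_path fe q" "homotopic Y y p q'"
    by blast
  then show "homotopic Y y p q" using map_path_inj[OF y _ q] by metis
next
  assume "homotopic Y y p q"
  then show "homotopic X (fv y) (map_path fe p) (map_path fe q)"
  proof (rule homotopic_mono)
    fix p q assume "path_move Y y p q"
    then obtain x m m' z where pq: "p = x @ m @ z" "q = x @ m' @ z" "base_move Y m m'"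
      "path_from Y y p" "path_from Y y q"
      by (rule path_moveE)
    have m: "base_move X (map_path fe m) (map_path fe m')"
      using pq(3) map_square unfolding base_move_iff by fastforce
    have "path_from X (fv y) (map_path fe p)" "path_from X (fv y) (map_path fe q)"
      using map_path_from pq(4,5) by blast+
    with path_moveI[OF m] have "path_move X (fv y) (map_path fe p) (map_path fe q)"
      unfolding pq by simp
    then show "homotopic X (fv y) (map_path fe p) (map_path fe q)" by (rule homotopic_move)
  qed
qed

text \<open>\<open>F p\<close> is the configuration that \<open>f\<close> assigns to the class of
  the projection of \<open>p\<close>. An extension witnessing the order in \<open>X\<close> starts
  over the endpoint of \<open>p\<close>, so it lifts to an extension of \<open>p\<close>.\<close>

lemma domain_as_paths_in_cover:
  fixes C :: "'a set set"
  assumes y: "y \<in> verts Y" and f: "bij_betw f C (principal_filter X (fv y))"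
    and order: "\<forall>c\<in>C. \<forall>c'\<in>C. c \<subseteq> c' \<longleftrightarrow> pf_le (f c) (f c')"
  shows "\<exists>F. F ` {p. path_from Y y p \<and> directed_path p} = C \<and>
    (\<forall>p q. path_from Y y p \<longrightarrow> directed_path p \<longrightarrow> path_from Y y q \<longrightarrow> directed_path q \<longrightarrow>
      (F p \<subseteq> F q \<longleftrightarrow> (\<exists>r. directed_path r \<and> path_from Y y (p @ r) \<and> homotopic Y y (p @ r) q)))"
proof -
  let ?h = "\<lambda>p. hclass X (fv y) (map_path fe p)"
  define F where "F p = inv_into C f (?h p)" for p
  have F: "F p \<in> C" "f (F p) = ?h p" if "path_from Y y p" "directed_path p" for p
  proof -
    have "?h p \<in> principal_filter X (fv y)"
      unfolding principal_filter_def using that map_path_from[OF that(1)] by auto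
    then have "?h p \<in> f ` C" using f by (simp add: bij_betw_def)
    then show "F p \<in> C" "f (F p) = ?h p" unfolding F_def by (simp_all add: inv_into_into f_inv_into_f)
  qed
  have "c \<in> F ` {p. path_from Y y p \<and> directed_path p}" if c: "c \<in> C" for c
  proof -
    have "f c \<in> principal_filter X (fv y)" using f c by (auto simp: bij_betw_def)
    then obtain q where q: "path_from X (fv y) q" "directed_path q" "f c = hclass X (fv y) q"
      unfolding principal_filter_def by auto
    then obtain p where p: "path_from Y y p" "map_path fe p = q" using lift_path[OF y] by auto
    moreover have "directed_path p" using q(2) p(2) directed_map_path by blast
    moreover have "F p = c" unfolding F_def p(2) q(3)[symmetric]
      using f c by (auto simp: bij_betw_def)
    ultimately show ?thesis by blast
  qed
  moreover have "F p \<subseteq> F q \<longleftrightarrow>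
      (\<exists>r. directed_path r \<and> path_from Y y (p @ r) \<and> homotopic Y y (p @ r) q)"
    if p: "path_from Y y p" "directed_path p" and q: "path_from Y y q" "directed_path q" for p q
  proof -
    have "F p \<subseteq> F q \<longleftrightarrow> pf_le (?h p) (?h q)" using order F[OF p] F[OF q] by simp
    also have "\<dots> \<longleftrightarrow> (\<exists>r. directed_path r \<and> path_from X (fv y) (map_path fe p @ r) \<and>
        homotopic X (fv y) (map_path fe p @ r) (map_path fe q))"
      using map_path_from p(1) q(1) by (intro pf_le_hclass[OF X(1)]) blast+
    also have "\<dots> \<longleftrightarrow> (\<exists>r. directed_path r \<and> path_from Y y (p @ r) \<and> homotopic Y y (p @ r) q)"
    proof
      assume "\<exists>r. directed_path r \<and> path_from X (fv y) (map_path fe p @ r) \<and>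
        homotopic X (fv y) (map_path fe p @ r) (map_path fe q)"
      then obtain r where r: "directed_path r" "path_from X (fv y) (map_path fe p @ r)"
        "homotopic X (fv y) (map_path fe p @ r) (map_path fe q)" by blast
      have "path_from X (fv (path_end Y y p)) r" using r(2) map_path_from[OF p(1)] by simp
      then obtain s where s: "path_from Y (path_end Y y p) s" "map_path fe s = r"
        using lift_path path_end_in_verts[OF Y(1) y p(1)] by blast
      have "path_from Y y (p @ s)" using p(1) s(1) by simp
      moreover from homotopic_map_path_iff[OF y this q(1)] have "homotopic Y y (p @ s) q"
        using r(3) s(2) by simp
      moreover have "directed_path s" using r(1) s(2) directed_map_path by blast
      ultimately show "\<exists>r. directed_path r \<and> path_from Y y (p @ r) \<and> homotopic Y y (p @ r) q"
        by blast
    next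
      assume "\<exists>r. directed_path r \<and> path_from Y y (p @ r) \<and> homotopic Y y (p @ r) q"
      then obtain r where r: "directed_path r" "path_from Y y (p @ r)" "homotopic Y y (p @ r) q"
        by blast
      have "homotopic X (fv y) (map_path fe (p @ r)) (map_path fe q)"
        using homotopic_map_path_iff[OF y r(2) q(1)] r(3) by simp
      moreover have "path_from X (fv y) (map_path fe (p @ r))" using map_path_from[OF r(2)] by simp
      ultimately show "\<exists>r. directed_path r \<and> path_from X (fv y) (map_path fe p @ r) \<and>
        homotopic X (fv y) (map_path fe p @ r) (map_path fe q)"
        using r(1) by (intro exI[of _ "map_path fe r"]) simp
    qed
    finally show ?thesis .
  qed
  ultimately show ?thesis using F(1) by (intro exI[of _ F]) blast
qed

end

theorem theorem5p2:
  fixes E :: "'a set" and le cf :: "'a \<Rightarrow> 'a \<Rightarrow> bool"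
  assumes "event_structure E le cf"
    and "cover_special E le cf"
  shows "regular_trace_event_structure E le cf"
proof -
  obtain X :: "(nat, nat) dcomplex" and u f where X: "virtually_special X" "u \<in> verts X"
    and f: "bij_betw f (configurations E le cf) (principal_filter X u)"
      "\<forall>c\<in>configurations E le cf. \<forall>c'\<in>configurations E le cf. c \<subseteq> c' \<longleftrightarrow> pf_le (f c) (f c')"
    using assms(2) unfolding cover_special_def by blast
  obtain Y :: "(nat, nat) dcomplex" and fv fe where Y: "dcomplex Y" "finite_dcomplex Y" "npc Y"
      "special Y" "covering_map Y X fv fe"
    using X(1) unfolding virtually_special_def by blast
  have "dcomplex X" "npc X" using X(1) by (simp_all add: virtually_special_def)
  with Y(1,3,5) interpret cov: covering Y X fv fe by unfold_locales
  have "fv ` verts Y = verts X" using Y(5) by (simp add: covering_map_def)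
  then obtain y where y: "y \<in> verts Y" "fv y = u" using X(2) by (metis imageE)
  obtain F where F: "F ` {p. path_from Y y p \<and> directed_path p} = configurations E le cf"
    "\<forall>p q. path_from Y y p \<longrightarrow> directed_path p \<longrightarrow> path_from Y y q \<longrightarrow> directed_path q \<longrightarrow>
      (F p \<subseteq> F q \<longleftrightarrow> (\<exists>r. directed_path r \<and> path_from Y y (p @ r) \<and> homotopic Y y (p @ r) q))"
    using cov.domain_as_paths_in_cover[OF y(1), unfolded y(2), OF f] by (elim exE conjE)
  interpret lab: labelled_complex Y "hyp_label Y" "crossing_labels Y"
    using Y(1,4) by (rule special_labelled_complex)
  interpret dom: labelled_domain Y "hyp_label Y" "crossing_labels Y" E le cf y F
    using assms(1) y(1) F by unfold_locales auto
  show ?thesis using Y(2) by (rule dom.regular_trace)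
qed

end
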